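(* Consider the controlled system, the functions $W_t$, $U_t$, $U_t^*$ and all assumptions specified in the context. Then for every $t=0,1,\ldots,T$, $$U^*_t(y)=W_t(y)\qquad\text{for all } y\in E_Y .$$ Moreover, let $\varphi^*=(\varphi^*_0,\ldots,\varphi^*_{T-1})$ be a policy consisting of Borel measurable maps $\varphi_t^*:E_Y\to A$ realizing the maxima in the recursion defining $W_t$, i.e. for all $t\in\{0,\ldots,T-1\}$ and $y=(x,c)\in E_Y$, $$W_t(y)=\inf_{\theta\in\tau(t,c)}\int_{E_Y}W_{t+1}(y')\,e^{\gamma\beta^t r_t(x,\varphi_t^*(y))}\,Q(dy'\mid t,y,\varphi_t^*(y),\theta).$$ Then $\varphi^*$ is adaptive robust-optimal, that is, with $\varphi^{t,*}=(\varphi^*_t,\ldots,\varphi^*_{T-1})$, $$U^*_t(y)=U_t(\varphi^{t,*},y)\qquad\text{for all } y\in E_Y,\ t=0,\ldots,T-1 .$$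
   Context: Setting. $T\in\mathbb N$ (with $T\ge 1$) is a finite horizon, $\mathbb N_0=\{0,1,2,\ldots\}$, $\mathcal T=\{0,\ldots,T\}$, $\mathcal T'=\{0,\ldots,T-1\}$. $\boldsymbol\Theta\subset\mathbb R^d$ is a non-empty compact parameter set, $A\subset\mathbb R^k$ is a non-empty finite set of control values, $\beta\in(0,1)$, $\gamma>0$. $Z=(Z_t)_{t\ge1}$ is an $\mathbb R^m$-valued process on a measurable space $(\Omega,\mathscr F)$ carrying a family of probability measures $\{\mathbb P_\theta,\theta\in\boldsymbol\Theta\}$; under $\mathbb P_\theta$ each $Z_t$ has a density $f_Z(\cdot;\theta)$ with respect to Lebesgue measure on $\mathbb R^m$ (not depending on $t$). Dynamics. $S:\mathbb R^n\times A\times\mathbb R^m\to\mathbb R^n$ is measurable; $R:\mathbb N_0\times\mathbb R^d\times\mathbb R^m\to\boldsymbol\Theta$ is measurable. The augmented state space is $E_Y=\mathbb R^n\times\boldsymbol\Theta$, with generic element $y=(x,c)$ and Borel $\sigma$-field $\mathcal E_Y$. Define $\mathbf G(t,y,a,z)=(S(x,a,z),R(t,c,z))\in E_Y$ and the kernel $$Q(B\mid t,y,a,\theta)=\mathbb P_\theta(\mathbf G(t,y,a,Z_{t+1})\in B)=\int_{\mathbb R^m}1_B(\mathbf G(t,y,a,z))f_Z(z;\theta)\,dz,\quad B\in\mathcal E_Y.$$ Confidence regions. For each $t\in\mathcal T'$, $\tau(t,\cdot):\mathbb R^d\to2^{\boldsymbol\Theta}$ is a measurable set-valued function with non-empty compact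 values, which is upper hemi-continuous: for any $c\in\boldsymbol\Theta$ and any open set $E$ with $\tau(t,c)\subset E\subset\boldsymbol\Theta$ (open relative to $\boldsymbol\Theta$) there is a neighbourhood $D$ of $c$ with $\tau(t,c')\subset E$ for all $c'\in D$. Rewards. For $t\in\mathcal T'$ and $a\in A$, $r_t(\cdot,a):\mathbb R^n\to\mathbb R_+$ is bounded and continuous; $r_T:\mathbb R^n\to\mathbb R_+$ is bounded and continuous; write $r_T(x,a)=r_T(x)$ (so that the control $\varphi_T$ appearing formally below is irrelevant). Standing assumptions. (i) $S(\cdot,a,z)$ is continuous for all $a,z$; (ii) $f_Z(z;\cdot)$ is continuous on $\boldsymbol\Theta$ for each $z$; (iii) $R(t,\cdot,\cdot)$ is continuous for each $t\in\mathcal T'$; (iv) for all $t\in\mathcal T'$, $a\in A$, $Q(dy'\mid t,y,a,\theta)$ is a Borel measurable stochastic kernel with respect to $(y,\theta)$. Strategies. All strategies are Markovian. $\mathcal A^t$ is the set of tuples $\varphi^t=(\varphi_t,\ldots,\varphi_{T-1})$ of Borel measurable maps $\varphi_k:E_Y\to A$. $\boldsymbol\Psi^t$ is the set of tuples $\psi^t=(\psi_t,\ldots,\psi_{T-1})$ of Borel measurable maps $\psi_k:E_Y\to\boldsymbol\Theta$ with $\psi_k(x,c)\in\tau(k,c)$ for all $(x,c)\in E_Y$. For $t\in\mathcal T'$, $y_t\in E_Y$, $\mathbb Q^{\varphi^t,\psi^t}_{y_t,t}$ is the probability measure on $E_Y^{T-t}$ (coordinates $Y_k=(X_k,C_k)$,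 $k=t+1,\ldots,T$) given by $$\mathbb Q^{\varphi^t,\psi^t}_{y_t,t}(B_{t+1}\times\cdots\times B_T)=\int_{B_{t+1}}\cdots\int_{B_T}\prod_{u=t+1}^TQ(dy_u\mid u-1,y_{u-1},\varphi_{u-1}(y_{u-1}),\psi_{u-1}(y_{u-1})),$$ and $\mathcal Q^{\varphi^t,\boldsymbol\Psi^t}_{y_t,t}=\{\mathbb Q^{\varphi^t,\psi^t}_{y_t,t}:\psi^t\in\boldsymbol\Psi^t\}$. Value functions. For $y=(x,c)\in E_Y$, $$U_t(\varphi^t,y)=e^{\gamma\beta^tr_t(x,\varphi_t(y))}\inf_{\mathbb Q\in\mathcal Q^{\varphi^t,\boldsymbol\Psi^t}_{y,t}}\mathbb E_{\mathbb Q}\,e^{\gamma\sum_{k=t+1}^T\beta^kr_k(X_k,\varphi_k(Y_k))},\quad t\in\mathcal T',$$ $$U_t^*(y)=\sup_{\varphi^t\in\mathcal A^t}U_t(\varphi^t,y)\ (t\in\mathcal T'),\qquad U_T^*(y)=e^{\gamma\beta^Tr_T(x)}.$$ Adaptive robust Bellman equations. $W_T(y)=e^{\gamma\beta^Tr_T(x)}$ and, for $t=T-1,\ldots,0$, $$W_t(y)=\max_{a\in A}\inf_{\theta\in\tau(t,c)}\int_{E_Y}W_{t+1}(y')e^{\gamma\beta^tr_t(x,a)}\,Q(dy'\mid t,y,a,\theta),\quad y=(x,c)\in E_Y.$$ The functions $W_t$ are lower semi-continuous, and Borel measurable maps realizing the maxima exist (proved separately in the paper). *)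

theory Defs
  imports "HOL-Probability.Probability"
begin

record ('n, 'd, 'k, 'm, 'w) robust_model =
  horizon :: nat
  params :: "(real^'d) set"
  controls :: "(real^'k) set"
  discount :: real
  risk :: real
  events :: "'w measure"
  prob_law :: "real^'d \<Rightarrow> 'w measure"
  noise :: "nat \<Rightarrow> 'w \<Rightarrow> real^'m"
  noise_density :: "real^'m \<Rightarrow> real^'d \<Rightarrow> real"
  dyn :: "real^'n \<Rightarrow> real^'k \<Rightarrow> real^'m \<Rightarrow> real^'n"
  estim :: "nat \<Rightarrow> real^'d \<Rightarrow> real^'m \<Rightarrow> real^'d"
  region :: "nat \<Rightarrow> real^'d \<Rightarrow> (real^'d) set"
  run_reward :: "nat \<Rightarrow> real^'n \<Rightarrow> real^'k \<Rightarrow> real"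
  end_reward :: "real^'n \<Rightarrow> real"

text \<open>In the paper's notation the fields are, in this order,
  $T$, $\Theta$, $A$, $\beta$, $\gamma$, the measurable space $(\Omega, F)$ (only the
  $\sigma$-algebra of \<open>events\<close> matters, not its measure), $P_\theta$, $Z_t$, $f_Z(z;\theta)$,
  $S$, $R$, $\tau$, $r_t$ for $t < T$, and $r_T$.\<close>

type_synonym ('n, 'd) state = "(real^'n) \<times> (real^'d)"

definition states :: "('n::finite, 'd::finite, 'k::finite, 'm::finite, 'w) robust_model \<Rightarrow> ('n, 'd) state set" where
  "states M = UNIV \<times> params M"

definition state_space :: "('n::finite, 'd::finite, 'k::finite, 'm::finite, 'w) robust_model \<Rightarrow> ('n, 'd) state measure" where
  "state_space M = restrict_space borel (states M)"

definition transition ::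
  "('n::finite, 'd::finite, 'k::finite, 'm::finite, 'w) robust_model \<Rightarrow> nat \<Rightarrow> ('n, 'd) state \<Rightarrow> real^'k \<Rightarrow> real^'m
    \<Rightarrow> ('n, 'd) state" where
  "transition M t y a z = (dyn M (fst y) a z, estim M t (snd y) z)"

definition Q_kernel ::
  "('n::finite, 'd::finite, 'k::finite, 'm::finite, 'w) robust_model \<Rightarrow> nat \<Rightarrow> ('n, 'd) state \<Rightarrow> real^'k \<Rightarrow> real^'d
    \<Rightarrow> ('n, 'd) state measure" where
  "Q_kernel M t y a \<theta> =
     distr (prob_law M \<theta>) (state_space M) (\<lambda>\<omega>. transition M t y a (noise M (Suc t) \<omega>))"

definition measurable_set_valued :: "('a::topological_space \<Rightarrow> 'b::topological_space set) \<Rightarrow> bool" where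
  "measurable_set_valued F \<longleftrightarrow> (\<forall>C. closed C \<longrightarrow> {c. F c \<inter> C \<noteq> {}} \<in> sets borel)"

definition upper_hemicontinuous_on ::
  "'a::topological_space set \<Rightarrow> ('a \<Rightarrow> 'a set) \<Rightarrow> bool" where
  "upper_hemicontinuous_on \<Theta> F \<longleftrightarrow>
     (\<forall>c\<in>\<Theta>. \<forall>E. openin (top_of_set \<Theta>) E \<and> F c \<subseteq> E \<longrightarrow>
        (\<exists>D. open D \<and> c \<in> D \<and> (\<forall>c'\<in>D. F c' \<subseteq> E)))"

locale adaptive_robust =
  fixes M :: "('n::finite, 'd::finite, 'k::finite, 'm::finite, 'w) robust_model"
  assumes horizon_ge_1: "1 \<le> horizon M"
    and params_compact: "compact (params M)"
    and params_nonempty: "params M \<noteq> {}"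
    and controls_finite: "finite (controls M)"
    and controls_nonempty: "controls M \<noteq> {}"
    and discount_pos: "0 < discount M"
    and discount_less_1: "discount M < 1"
    and risk_pos: "0 < risk M"
    and prob_law_prob: "\<And>\<theta>. \<theta> \<in> params M \<Longrightarrow> prob_space (prob_law M \<theta>)"
    and prob_law_sets: "\<And>\<theta>. \<theta> \<in> params M \<Longrightarrow> sets (prob_law M \<theta>) = sets (events M)"
    and noise_measurable: "\<And>t. 1 \<le> t \<Longrightarrow> noise M t \<in> events M \<rightarrow>\<^sub>M borel"
    and noise_density_nonneg: "\<And>z \<theta>. \<theta> \<in> params M \<Longrightarrow> 0 \<le> noise_density M z \<theta>"
    and noise_distributed: "\<And>t \<theta>. 1 \<le> t \<Longrightarrow> \<theta> \<in> params M \<Longrightarrow>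
          distributed (prob_law M \<theta>) lborel (noise M t) (\<lambda>z. ennreal (noise_density M z \<theta>))"
    and dyn_measurable: "(\<lambda>(x, a, z). dyn M x a z)
          \<in> borel_measurable (restrict_space borel (UNIV \<times> controls M \<times> UNIV))"
    and estim_measurable: "(\<lambda>(t, c, z). estim M t c z)
          \<in> count_space UNIV \<Otimes>\<^sub>M (borel \<Otimes>\<^sub>M borel) \<rightarrow>\<^sub>M restrict_space borel (params M)"
    and region_subset: "\<And>t c. t < horizon M \<Longrightarrow> region M t c \<subseteq> params M"
    and region_nonempty: "\<And>t c. t < horizon M \<Longrightarrow> region M t c \<noteq> {}"
    and region_compact: "\<And>t c. t < horizon M \<Longrightarrow> compact (region M t c)"
    and region_measurable: "\<And>t. t < horizon M \<Longrightarrow> measurable_set_valued (region M t)"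
    and region_uhc: "\<And>t. t < horizon M \<Longrightarrow> upper_hemicontinuous_on (params M) (region M t)"
    and run_reward_nonneg: "\<And>t x a. t < horizon M \<Longrightarrow> a \<in> controls M \<Longrightarrow> 0 \<le> run_reward M t x a"
    and run_reward_bounded: "\<And>t a. t < horizon M \<Longrightarrow> a \<in> controls M \<Longrightarrow>
          bounded (range (\<lambda>x. run_reward M t x a))"
    and run_reward_continuous: "\<And>t a. t < horizon M \<Longrightarrow> a \<in> controls M \<Longrightarrow>
          continuous_on UNIV (\<lambda>x. run_reward M t x a)"
    and end_reward_nonneg: "\<And>x. 0 \<le> end_reward M x"
    and end_reward_bounded: "bounded (range (end_reward M))"
    and end_reward_continuous: "continuous_on UNIV (end_reward M)"
    and dyn_continuous: "\<And>a z. a \<in> controls M \<Longrightarrow> continuous_on UNIV (\<lambda>x. dyn M x a z)"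
    and noise_density_continuous: "\<And>z. continuous_on (params M) (noise_density M z)"
    and estim_continuous: "\<And>t. t < horizon M \<Longrightarrow> continuous_on UNIV (\<lambda>(c, z). estim M t c z)"
    and Q_kernel_measurable: "\<And>t a. t < horizon M \<Longrightarrow> a \<in> controls M \<Longrightarrow>
          (\<lambda>(y, \<theta>). Q_kernel M t y a \<theta>)
            \<in> state_space M \<Otimes>\<^sub>M restrict_space borel (params M) \<rightarrow>\<^sub>M prob_algebra (state_space M)"

definition control_strategies ::
  "('n::finite, 'd::finite, 'k::finite, 'm::finite, 'w) robust_model \<Rightarrow> nat \<Rightarrow> (nat \<Rightarrow> ('n, 'd) state \<Rightarrow> real^'k) set" where
  "control_strategies M t =
     (\<Pi>\<^sub>E k\<in>{t..<horizon M}. state_space M \<rightarrow>\<^sub>M restrict_space borel (controls M))"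

definition nature_strategies ::
  "('n::finite, 'd::finite, 'k::finite, 'm::finite, 'w) robust_model \<Rightarrow> nat \<Rightarrow> (nat \<Rightarrow> ('n, 'd) state \<Rightarrow> real^'d) set" where
  "nature_strategies M t =
     {\<psi> \<in> \<Pi>\<^sub>E k\<in>{t..<horizon M}. state_space M \<rightarrow>\<^sub>M restrict_space borel (params M).
        \<forall>k\<in>{t..<horizon M}. \<forall>(x, c)\<in>states M. \<psi> k (x, c) \<in> region M k c}"

text \<open>\<open>path_steps M \<phi> \<psi> n t y\<close> is the law of $(Y_{t+1}, \dots, Y_{t+n})$ started in
  $Y_t = y$. Lemma \<open>path_law_rectangle\<close> below shows that on rectangles it is the
  iterated integral of the kernels.\<close>

primrec path_steps ::
  "('n::finite, 'd::finite, 'k::finite, 'm::finite, 'w) robust_model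
    \<Rightarrow> (nat \<Rightarrow> ('n, 'd) state \<Rightarrow> real^'k) \<Rightarrow> (nat \<Rightarrow> ('n, 'd) state \<Rightarrow> real^'d)
    \<Rightarrow> nat \<Rightarrow> nat \<Rightarrow> ('n, 'd) state \<Rightarrow> (nat \<Rightarrow> ('n, 'd) state) measure" where
  "path_steps M \<phi> \<psi> 0 t y = return (\<Pi>\<^sub>M k\<in>{}. state_space M) (\<lambda>_. undefined)"
| "path_steps M \<phi> \<psi> (Suc n) t y =
     Q_kernel M t y (\<phi> t y) (\<psi> t y) \<bind>
       (\<lambda>y'. distr (path_steps M \<phi> \<psi> n (Suc t) y')
               (\<Pi>\<^sub>M k\<in>{t<..t + Suc n}. state_space M) (\<lambda>\<omega>. fun_upd \<omega> (Suc t) y'))"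

definition path_law ::
  "('n::finite, 'd::finite, 'k::finite, 'm::finite, 'w) robust_model \<Rightarrow> nat
    \<Rightarrow> (nat \<Rightarrow> ('n, 'd) state \<Rightarrow> real^'k) \<Rightarrow> (nat \<Rightarrow> ('n, 'd) state \<Rightarrow> real^'d)
    \<Rightarrow> ('n, 'd) state \<Rightarrow> (nat \<Rightarrow> ('n, 'd) state) measure" where
  "path_law M t \<phi> \<psi> y = path_steps M \<phi> \<psi> (horizon M - t) t y"

definition path_laws ::
  "('n::finite, 'd::finite, 'k::finite, 'm::finite, 'w) robust_model \<Rightarrow> nat
    \<Rightarrow> (nat \<Rightarrow> ('n, 'd) state \<Rightarrow> real^'k) \<Rightarrow> ('n, 'd) state \<Rightarrow> (nat \<Rightarrow> ('n, 'd) state) measure set" where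
  "path_laws M t \<phi> y = (\<lambda>\<psi>. path_law M t \<phi> \<psi> y) ` nature_strategies M t"

definition reward ::
  "('n::finite, 'd::finite, 'k::finite, 'm::finite, 'w) robust_model \<Rightarrow> nat \<Rightarrow> real^'n \<Rightarrow> real^'k \<Rightarrow> real" where
  "reward M t x a = (if t = horizon M then end_reward M x else run_reward M t x a)"

definition U_value ::
  "('n::finite, 'd::finite, 'k::finite, 'm::finite, 'w) robust_model \<Rightarrow> nat
    \<Rightarrow> (nat \<Rightarrow> ('n, 'd) state \<Rightarrow> real^'k) \<Rightarrow> ('n, 'd) state \<Rightarrow> real" where
  "U_value M t \<phi> y =
     exp (risk M * discount M ^ t * reward M t (fst y) (\<phi> t y)) *
     (INF \<Q>\<in>path_laws M t \<phi> y.
        \<integral>\<omega>. exp (risk M * (\<Sum>k\<in>{t<..horizon M}. discount M ^ k * reward M k (fst (\<omega> k)) (\<phi> k (\<omega> k)))) \<partial>\<Q>)"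

definition U_opt ::
  "('n::finite, 'd::finite, 'k::finite, 'm::finite, 'w) robust_model \<Rightarrow> nat \<Rightarrow> ('n, 'd) state \<Rightarrow> real" where
  "U_opt M t y =
     (if t < horizon M then (SUP \<phi>\<in>control_strategies M t. U_value M t \<phi> y)
      else exp (risk M * discount M ^ horizon M * end_reward M (fst y)))"

definition bellman_inf ::
  "('n::finite, 'd::finite, 'k::finite, 'm::finite, 'w) robust_model \<Rightarrow> nat
    \<Rightarrow> (('n, 'd) state \<Rightarrow> real) \<Rightarrow> ('n, 'd) state \<Rightarrow> real^'k \<Rightarrow> real" where
  "bellman_inf M t V y a =
     (INF \<theta>\<in>region M t (snd y).
        \<integral>y'. V y' * exp (risk M * discount M ^ t * reward M t (fst y) a) \<partial>Q_kernel M t y a \<theta>)"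

function W_value ::
  "('n::finite, 'd::finite, 'k::finite, 'm::finite, 'w) robust_model \<Rightarrow> nat \<Rightarrow> ('n, 'd) state \<Rightarrow> real" where
  "W_value M t y =
     (if t < horizon M then Max (bellman_inf M t (W_value M (Suc t)) y ` controls M)
      else exp (risk M * discount M ^ horizon M * end_reward M (fst y)))"
  by pat_completeness auto
termination
  by (relation "Wellfounded.measure (\<lambda>(M, t, y). horizon M - t)") auto

declare W_value.simps [simp del]

lemma space_state_space: "space (state_space M) = states M"
  by (simp add: state_space_def space_restrict_space)

context adaptive_robust
begin

lemma transition_measurable:
  assumes t: "t < horizon M" and y: "y \<in> states M" and a: "a \<in> controls M"
  shows "transition M t y a \<in> borel \<rightarrow>\<^sub>M state_space M"
proof -
  have "(\<lambda>z. (fst y, a, z)) \<in> borel \<rightarrow>\<^sub>M restrict_space borel (UNIV \<times> controls M \<times> UNIV)"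
    using a by (intro measurable_restrict_space2) (auto intro!: borel_measurable_continuous_onI continuous_intros)
  from measurable_compose[OF this dyn_measurable]
  have 1: "(\<lambda>z. dyn M (fst y) a z) \<in> borel_measurable borel"
    by simp
  have "(\<lambda>z. (t, snd y, z)) \<in> borel \<rightarrow>\<^sub>M count_space UNIV \<Otimes>\<^sub>M (borel \<Otimes>\<^sub>M borel)"
    by measurable
  from measurable_compose[OF this estim_measurable]
  have 2: "(\<lambda>z. estim M t (snd y) z) \<in> borel \<rightarrow>\<^sub>M restrict_space borel (params M)"
    by simp
  then have 3: "estim M t (snd y) z \<in> params M" for z
    by (auto simp: measurable_restrict_space2_iff)
  from 2 have 4: "(\<lambda>z. estim M t (snd y) z) \<in> borel_measurable borel"
    by (auto simp: measurable_restrict_space2_iff)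
  show ?thesis
    unfolding state_space_def states_def
    using 1 3 4 by (intro measurable_restrict_space2) (auto simp: transition_def[abs_def])
qed

lemma Q_kernel_density:
  assumes "t < horizon M" "y \<in> states M" "a \<in> controls M" "\<theta> \<in> params M" "B \<in> sets (state_space M)"
  shows "emeasure (Q_kernel M t y a \<theta>) B =
    (\<integral>\<^sup>+z. indicator B (transition M t y a z) * ennreal (noise_density M z \<theta>) \<partial>lborel)"
proof -
  note D = noise_distributed[of "Suc t" \<theta>, simplified, OF assms(4)]
  note [measurable] = transition_measurable[OF assms(1-3)] assms(5)
  have tr [measurable]: "transition M t y a \<in> lborel \<rightarrow>\<^sub>M state_space M"
    by simp
  have f [measurable]: "(\<lambda>z. ennreal (noise_density M z \<theta>)) \<in> borel_measurable lborel"
    using D by (simp add: distributed_def)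
  have Z [measurable]: "noise M (Suc t) \<in> prob_law M \<theta> \<rightarrow>\<^sub>M lborel"
    using D by (simp add: distributed_def)
  have "Q_kernel M t y a \<theta> =
      distr (distr (prob_law M \<theta>) lborel (noise M (Suc t))) (state_space M) (transition M t y a)"
    unfolding Q_kernel_def by (subst distr_distr[OF tr Z]) (simp add: comp_def)
  also have "distr (prob_law M \<theta>) lborel (noise M (Suc t)) =
      density lborel (\<lambda>z. ennreal (noise_density M z \<theta>))"
    using D by (simp add: distributed_def)
  finally have eq: "Q_kernel M t y a \<theta> = distr (density lborel (\<lambda>z. ennreal (noise_density M z \<theta>)))
      (state_space M) (transition M t y a)" .
  have "emeasure (Q_kernel M t y a \<theta>) B =
      (\<integral>\<^sup>+y'. indicator B y' \<partial>Q_kernel M t y a \<theta>)"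
    by (rule nn_integral_indicator[symmetric]) (simp add: Q_kernel_def)
  also have "\<dots> = (\<integral>\<^sup>+z. indicator B (transition M t y a z) \<partial>density lborel (\<lambda>z. ennreal (noise_density M z \<theta>)))"
    unfolding eq by (subst nn_integral_distr) auto
  also have "\<dots> = (\<integral>\<^sup>+z. ennreal (noise_density M z \<theta>) * indicator B (transition M t y a z) \<partial>lborel)"
    by (subst nn_integral_density) auto
  finally show ?thesis
    by (simp add: mult.commute)
qed

lemma strategy_kernel_measurable:
  assumes t: "t < horizon M"
    and f: "f \<in> state_space M \<rightarrow>\<^sub>M restrict_space borel (controls M)"
    and g: "g \<in> state_space M \<rightarrow>\<^sub>M restrict_space borel (params M)"
  shows "(\<lambda>y. Q_kernel M t y (f y) (g y)) \<in> state_space M \<rightarrow>\<^sub>M prob_algebra (state_space M)"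
proof (rule measurable_compose_countable'[where I = "controls M" and g = f
    and f = "\<lambda>a y. Q_kernel M t y a (g y)"])
  show "countable (controls M)"
    using controls_finite by (rule countable_finite)
  show "(\<lambda>y. Q_kernel M t y a (g y)) \<in> state_space M \<rightarrow>\<^sub>M prob_algebra (state_space M)"
    if "a \<in> controls M" for a
    using measurable_compose[OF measurable_Pair[OF measurable_ident g] Q_kernel_measurable[OF t that]]
    by simp
  have "f -` {a} \<inter> space (state_space M) \<in> sets (state_space M)" for a
    using measurable_sets[of f "state_space M" borel "{a}"] f
    by (auto simp: measurable_restrict_space2_iff)
  moreover have "f \<in> space (state_space M) \<rightarrow> controls M"
    using f by (auto simp: measurable_restrict_space2_iff)
  ultimately show "f \<in> state_space M \<rightarrow>\<^sub>M count_space (controls M)"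
    using controls_finite
    by (simp add: measurable_count_space_eq2)
qed

lemma path_steps_measurable:
  assumes "t + n \<le> horizon M"
    and "\<And>k. k \<in> {t..<horizon M} \<Longrightarrow> \<phi> k \<in> state_space M \<rightarrow>\<^sub>M restrict_space borel (controls M)"
    and "\<And>k. k \<in> {t..<horizon M} \<Longrightarrow> \<psi> k \<in> state_space M \<rightarrow>\<^sub>M restrict_space borel (params M)"
  shows "path_steps M \<phi> \<psi> n t \<in> state_space M \<rightarrow>\<^sub>M prob_algebra (\<Pi>\<^sub>M k\<in>{t<..t + n}. state_space M)"
  using assms
proof (induction n arbitrary: t)
  case 0
  have "return (\<Pi>\<^sub>M k\<in>{}. state_space M) (\<lambda>_. undefined) \<in> space (prob_algebra (\<Pi>\<^sub>M k\<in>{}. state_space M))"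
    by (auto simp: space_prob_algebra space_PiM intro!: prob_space_return)
  then show ?case
    by simp
next
  case (Suc n)
  have IH: "path_steps M \<phi> \<psi> n (Suc t)
      \<in> state_space M \<rightarrow>\<^sub>M prob_algebra (\<Pi>\<^sub>M k\<in>{Suc t<..Suc t + n}. state_space M)"
    using Suc.prems by (intro Suc.IH) auto
  have ins: "{t<..t + Suc n} = insert (Suc t) {Suc t<..Suc t + n}"
    by auto
  have upd: "(\<lambda>(y', \<omega>). fun_upd \<omega> (Suc t) y') \<in> state_space M \<Otimes>\<^sub>M (\<Pi>\<^sub>M k\<in>{Suc t<..Suc t + n}. state_space M)
      \<rightarrow>\<^sub>M (\<Pi>\<^sub>M k\<in>{t<..t + Suc n}. state_space M)"
    unfolding ins split_beta' by (rule measurable_fun_upd[where J = "{Suc t<..Suc t + n}"]) auto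
  have k: "(\<lambda>y. Q_kernel M t y (\<phi> t y) (\<psi> t y)) \<in> state_space M \<rightarrow>\<^sub>M prob_algebra (state_space M)"
    using Suc.prems by (intro strategy_kernel_measurable) auto
  show ?case
    unfolding path_steps.simps
    by (intro measurable_bind_prob_space[OF k] measurable_distr_prob_space2[OF IH upd])
qed

lemma path_law_prob:
  assumes "t \<le> horizon M" "y \<in> states M" "\<phi> \<in> control_strategies M t" "\<psi> \<in> nature_strategies M t"
  shows "path_law M t \<phi> \<psi> y \<in> space (prob_algebra (\<Pi>\<^sub>M k\<in>{t<..horizon M}. state_space M))"
  using measurable_space[OF path_steps_measurable[of t "horizon M - t" \<phi> \<psi>], of y] assms
  by (auto simp: path_law_def space_state_space control_strategies_def nature_strategies_def PiE_iff)

lemma path_law_rectangle: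
  assumes t: "t < horizon M" and y: "y \<in> states M"
    and \<phi>: "\<phi> \<in> control_strategies M t" and \<psi>: "\<psi> \<in> nature_strategies M t"
    and B: "\<And>k. k \<in> {t<..horizon M} \<Longrightarrow> B k \<in> sets (state_space M)"
  shows "emeasure (path_law M t \<phi> \<psi> y) (\<Pi>\<^sub>E k\<in>{t<..horizon M}. B k) =
    (\<integral>\<^sup>+y'\<in>B (Suc t). emeasure (path_law M (Suc t) \<phi> \<psi> y') (\<Pi>\<^sub>E k\<in>{Suc t<..horizon M}. B k)
       \<partial>Q_kernel M t y (\<phi> t y) (\<psi> t y))"
proof -
  define n where "n = horizon M - Suc t"
  have T: "horizon M = Suc (t + n)" "horizon M - t = Suc n" "horizon M - Suc t = n"
    using t by (auto simp: n_def)
  have \<phi>': "\<phi> k \<in> state_space M \<rightarrow>\<^sub>M restrict_space borel (controls M)" if "k \<in> {t..<horizon M}" for k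
    using \<phi> that by (auto simp: control_strategies_def PiE_iff)
  have \<psi>': "\<psi> k \<in> state_space M \<rightarrow>\<^sub>M restrict_space borel (params M)" if "k \<in> {t..<horizon M}" for k
    using \<psi> that by (auto simp: nature_strategies_def PiE_iff)
  let ?I = "{Suc t<..Suc t + n}" and ?J = "{t<..t + Suc n}"
  let ?K = "Q_kernel M t y (\<phi> t y) (\<psi> t y)"
  have P: "path_steps M \<phi> \<psi> n (Suc t) \<in> state_space M \<rightarrow>\<^sub>M prob_algebra (\<Pi>\<^sub>M k\<in>?I. state_space M)"
    using T \<phi>' \<psi>' by (intro path_steps_measurable) auto
  have ins: "?J = insert (Suc t) ?I"
    by auto
  have upd: "(\<lambda>(y', \<omega>). fun_upd \<omega> (Suc t) y') \<in> state_space M \<Otimes>\<^sub>M (\<Pi>\<^sub>M k\<in>?I. state_space M)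
      \<rightarrow>\<^sub>M (\<Pi>\<^sub>M k\<in>?J. state_space M)"
    unfolding ins split_beta' by (rule measurable_fun_upd[where J = ?I]) auto
  have K: "?K \<in> space (prob_algebra (state_space M))"
    using measurable_space[OF strategy_kernel_measurable[OF t \<phi>' \<psi>'], of t t y] t y
    by (auto simp: space_state_space)
  then have setsK [measurable_cong]: "sets ?K = sets (state_space M)" and "prob_space ?K"
    by (auto simp: space_prob_algebra)
  have neK: "space ?K \<noteq> {}"
    using \<open>prob_space ?K\<close> by (rule prob_space.not_empty)
  have spK: "space ?K = space (state_space M)"
    using setsK by (rule sets_eq_imp_space_eq)
  have D: "(\<lambda>y'. distr (path_steps M \<phi> \<psi> n (Suc t) y') (\<Pi>\<^sub>M k\<in>?J. state_space M) (\<lambda>\<omega>. fun_upd \<omega> (Suc t) y'))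
      \<in> ?K \<rightarrow>\<^sub>M subprob_algebra (\<Pi>\<^sub>M k\<in>?J. state_space M)"
    using measurable_prob_algebraD[OF measurable_distr_prob_space2[OF P upd]]
    by (simp cong: measurable_cong_sets add: setsK)
  have BJ: "(\<Pi>\<^sub>E k\<in>?J. B k) \<in> sets (\<Pi>\<^sub>M k\<in>?J. state_space M)"
    using B T by (intro sets_PiM_I_finite) auto
  have "emeasure (path_law M t \<phi> \<psi> y) (\<Pi>\<^sub>E k\<in>{t<..horizon M}. B k) =
      (\<integral>\<^sup>+y'. emeasure (distr (path_steps M \<phi> \<psi> n (Suc t) y') (\<Pi>\<^sub>M k\<in>?J. state_space M)
         (\<lambda>\<omega>. fun_upd \<omega> (Suc t) y')) (\<Pi>\<^sub>E k\<in>?J. B k) \<partial>?K)"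
    unfolding path_law_def T path_steps.simps
    using emeasure_bind[OF neK D BJ] by simp
  also have "\<dots> = (\<integral>\<^sup>+y'\<in>B (Suc t). emeasure (path_steps M \<phi> \<psi> n (Suc t) y') (\<Pi>\<^sub>E k\<in>?I. B k) \<partial>?K)"
  proof (rule nn_integral_cong)
    fix y' assume "y' \<in> space ?K"
    then have y': "y' \<in> space (state_space M)"
      by (simp add: spK)
    let ?N = "path_steps M \<phi> \<psi> n (Suc t) y'"
    have setsN: "sets ?N = sets (\<Pi>\<^sub>M k\<in>?I. state_space M)"
      using measurable_space[OF P y'] by (simp add: space_prob_algebra)
    then have spN: "space ?N = (\<Pi>\<^sub>E k\<in>?I. states M)"
      by (simp add: sets_eq_imp_space_eq[OF setsN] space_PiM space_state_space)
    have u: "(\<lambda>\<omega>. fun_upd \<omega> (Suc t) y') \<in> ?N \<rightarrow>\<^sub>M (\<Pi>\<^sub>M k\<in>?J. state_space M)"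
      using measurable_compose[OF measurable_Pair1'[OF y'] upd]
      by (simp cong: measurable_cong_sets add: setsN)
    have sub: "B k \<subseteq> states M" if "k \<in> ?J" for k
      using sets.sets_into_space[OF B[of k]] that T by (auto simp: space_state_space)
    have pre: "(\<lambda>\<omega>. fun_upd \<omega> (Suc t) y') -` (\<Pi>\<^sub>E k\<in>?J. B k) \<inter> space ?N =
        (if y' \<in> B (Suc t) then (\<Pi>\<^sub>E k\<in>?I. B k) else {})"
    proof -
      have "fun_upd \<omega> (Suc t) y' \<in> (\<Pi>\<^sub>E k\<in>?J. B k) \<longleftrightarrow> y' \<in> B (Suc t) \<and> \<omega> \<in> (\<Pi>\<^sub>E k\<in>?I. B k)"
        if "\<omega> \<in> (\<Pi>\<^sub>E k\<in>?I. states M)" for \<omega>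
      proof -
        have "k \<noteq> Suc t" if "k \<in> ?I" for k
          using that by simp
        moreover have "\<omega> \<in> extensional ?I"
          using that by (simp add: PiE_iff)
        moreover have "fun_upd \<omega> (Suc t) y' \<in> extensional ?J"
          using \<open>\<omega> \<in> extensional ?I\<close> unfolding ins by (simp add: extensional_def)
        ultimately show ?thesis
          unfolding PiE_iff unfolding ins by (simp del: greaterThanAtMost_iff)
      qed
      moreover have "(\<Pi>\<^sub>E k\<in>?I. B k) \<subseteq> (\<Pi>\<^sub>E k\<in>?I. states M)"
        using sub by (intro PiE_mono) auto
      ultimately show ?thesis
        unfolding spN by auto
    qed
    show "emeasure (distr ?N (\<Pi>\<^sub>M k\<in>?J. state_space M) (\<lambda>\<omega>. fun_upd \<omega> (Suc t) y')) (\<Pi>\<^sub>E k\<in>?J. B k) =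
        emeasure ?N (\<Pi>\<^sub>E k\<in>?I. B k) * indicator (B (Suc t)) y'"
      unfolding emeasure_distr[OF u BJ] pre by (simp add: indicator_def)
  qed
  finally show ?thesis
    by (simp add: path_law_def T)
qed

end

end

theory Submission
  imports Defs
begin

text \<open>By backward induction every \<open>W\<^sub>t\<close> is bounded and lower semicontinuous: Fatou's lemma and the
  continuity of the dynamics and of the noise density make the one-step integral jointly lower
  semicontinuous in state and parameter, upper hemicontinuity of the compact-valued confidence
  regions preserves this under the infimum, and the maximum is over finitely many controls.
  Lower semicontinuity also provides Borel selectors of minimising parameters. Against any control
  strategy, nature answers with these minimisers and keeps the payoff below \<open>W\<^sub>t\<close>; conversely a
  measurable maximising control guarantees at least \<open>W\<^sub>t\<close> against every answer of nature.\<close>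

text \<open>The crux is that an answer of nature must be a Borel map: parameters picked state by
  state need not form an admissible strategy. The infimum is attained on the compact regions, so
  exact minimisers can be selected and no epsilon has to be carried through the stages. They are
  chosen at each stage against \<open>W_value\<close> and not against the payoff of the later play,
  so a single Markov answer works from every initial state. The estimates are made in
  \<open>ennreal\<close>, where Fatou's lemma and monotonicity carry no integrability conditions.
  The value functions are defined by Bochner integrals and by real infima and suprema, so the return
  to the reals has to supply boundedness, finiteness and non-empty index sets.\<close>

text \<open>Non-negativity bounds the real infimum from below. Non-emptiness makes the infimum in
  \<open>ennreal\<close> finite, so that it survives the passage through
  \<open>enn2real\<close>.\<close>

lemma ennreal_cINF:
  assumes "I \<noteq> {}" "\<And>i. i \<in> I \<Longrightarrow> 0 \<le> f i"
  shows "ennreal (INF i\<in>I. f i) = (INF i\<in>I. ennreal (f i))"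
proof (rule antisym)
  have bdd: "bdd_below (f ` I)"
    using assms(2) by (intro bdd_belowI[of _ 0]) auto
  show "ennreal (INF i\<in>I. f i) \<le> (INF i\<in>I. ennreal (f i))"
    by (intro INF_greatest ennreal_leI cINF_lower bdd)
  let ?r = "INF i\<in>I. ennreal (f i)"
  obtain i where "i \<in> I"
    using assms(1) by blast
  then have "?r \<le> ennreal (f i)"
    by (rule INF_lower)
  then have fin: "?r < top"
    by (rule le_less_trans) simp
  have "enn2real ?r \<le> (INF i\<in>I. f i)"
    using assms by (intro cINF_greatest enn2real_leI INF_lower) auto
  then have "ennreal (enn2real ?r) \<le> ennreal (INF i\<in>I. f i)"
    by (rule ennreal_leI)
  then show "?r \<le> ennreal (INF i\<in>I. f i)"
    using fin by simp
qed

section \<open>Lower semicontinuity\<close>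

text \<open>The sequential form is the one that Fatou's lemma delivers; all domains to which it is
  applied are first countable.\<close>

definition lsc_on :: "'a::topological_space set \<Rightarrow> ('a \<Rightarrow> ennreal) \<Rightarrow> bool" where
  "lsc_on S f \<longleftrightarrow>
     (\<forall>x\<in>S. \<forall>X. (\<forall>n. X n \<in> S) \<and> X \<longlonglongrightarrow> x \<longrightarrow> f x \<le> liminf (\<lambda>n. f (X n)))"

lemma lsc_onD:
  assumes "lsc_on S f" "x \<in> S" "\<And>n. X n \<in> S" "X \<longlonglongrightarrow> x"
  shows "f x \<le> liminf (\<lambda>n. f (X n))"
  using assms unfolding lsc_on_def by blast

lemma lsc_on_cong: "(\<And>x. x \<in> S \<Longrightarrow> f x = g x) \<Longrightarrow> lsc_on S f \<longleftrightarrow> lsc_on S g"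
  unfolding lsc_on_def by (intro ball_cong all_cong imp_cong) auto

lemma lsc_on_bound_lim:
  assumes "lsc_on S f" "x \<in> S" "\<And>n. X n \<in> S" "X \<longlonglongrightarrow> x" "\<And>n. f (X n) \<le> \<alpha>"
  shows "f x \<le> \<alpha>"
proof -
  have "f x \<le> liminf (\<lambda>n. f (X n))"
    using assms(1-4) by (rule lsc_onD)
  also have "\<dots> \<le> \<alpha>"
    using assms(5) by (intro Liminf_le) auto
  finally show ?thesis .
qed

text \<open>If semicontinuity fails at \<open>x\<close>, some \<open>\<alpha> < f x\<close> bounds
  infinitely many terms. Along that subsequence it bounds every term, so sequences inside a sublevel
  set are enough to test.\<close>

lemma lsc_onI_bound:
  assumes "\<And>x X \<alpha>. x \<in> S \<Longrightarrow> (\<And>n. X n \<in> S) \<Longrightarrow> X \<longlonglongrightarrow> x \<Longrightarrow> (\<And>n. f (X n) \<le> \<alpha>) \<Longrightarrow> f x \<le> \<alpha>"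
  shows "lsc_on S f"
  unfolding lsc_on_def le_Liminf_iff
proof (intro ballI allI impI, elim conjE)
  fix x X \<alpha> assume x: "x \<in> S" and X: "\<forall>n. X n \<in> S" "X \<longlonglongrightarrow> x" and \<alpha>: "\<alpha> < f x"
  show "eventually (\<lambda>n. \<alpha> < f (X n)) sequentially"
  proof (rule ccontr)
    assume "\<not> ?thesis"
    then have "\<exists>r :: nat \<Rightarrow> nat. strict_mono r \<and> (\<forall>n. \<not> \<alpha> < f (X (r n)))"
      by (rule not_eventually_sequentiallyD)
    then obtain r :: "nat \<Rightarrow> nat" where r: "strict_mono r" "\<And>n. \<not> \<alpha> < f (X (r n))"
      by blast
    have "f x \<le> \<alpha>"
      using x X r LIMSEQ_subseq_LIMSEQ[OF X(2) r(1)]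
      by (intro assms[of x "X \<circ> r"]) (auto simp: not_less)
    with \<alpha> show False by simp
  qed
qed

lemma lsc_on_measurable:
  fixes f :: "'a::first_countable_topology \<Rightarrow> ennreal"
  assumes "lsc_on S f"
  shows "f \<in> borel_measurable (restrict_space borel S)"
proof (rule borel_measurableI_le)
  fix \<alpha>
  let ?L = "{x \<in> S. f x \<le> \<alpha>}"
  \<comment> \<open>Sublevel sets are relatively closed in \<open>S\<close>, hence Borel there even
    when \<open>S\<close> itself is arbitrary.\<close>
  have "?L = S \<inter> closure ?L"
  proof (intro equalityI subsetI)
    fix x assume x: "x \<in> S \<inter> closure ?L"
    then have "x \<in> closure ?L"
      by (rule IntD2)
    then obtain X where "\<And>n. X n \<in> ?L" "X \<longlonglongrightarrow> x"
      using closure_sequential[of x ?L] by blast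
    with x show "x \<in> ?L"
      using lsc_on_bound_lim[OF assms, of x X \<alpha>] by auto
  qed (use closure_subset[of ?L] in auto)
  then have "?L \<in> sets (restrict_space borel S)"
    by (metis (no_types, lifting) borel_closed closed_closure imageI sets_restrict_space)
  then show "{x \<in> space (restrict_space borel S). f x \<le> \<alpha>} \<in> sets (restrict_space borel S)"
    by (simp add: space_restrict_space)
qed

lemma lsc_on_SUP:
  assumes "\<And>i. i \<in> I \<Longrightarrow> lsc_on S (f i)"
  shows "lsc_on S (\<lambda>x. SUP i\<in>I. f i x)"
proof (rule lsc_onI_bound)
  fix x X \<alpha> assume X: "x \<in> S" "\<And>n. X n \<in> S" "X \<longlonglongrightarrow> x" and le: "\<And>n. (SUP i\<in>I. f i (X n)) \<le> \<alpha>"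
  show "(SUP i\<in>I. f i x) \<le> \<alpha>"
  proof (rule SUP_least)
    fix i assume i: "i \<in> I"
    then have "f i (X n) \<le> \<alpha>" for n
      using le[of n] by (meson SUP_upper order_trans)
    then show "f i x \<le> \<alpha>"
      using lsc_on_bound_lim[OF assms[OF i] X] by blast
  qed
qed

text \<open>Multiplication on \<open>ennreal\<close> is not continuous where 0 meets
  \<open>top\<close>. Replacing \<open>u\<close> by a constant \<open>c < a\<close>, which is
  finite, avoids that case; the supremum over such \<open>c\<close> then recovers
  \<open>a\<close>.\<close>

lemma liminf_mult_ge:
  fixes u v :: "nat \<Rightarrow> ennreal"
  assumes u: "a \<le> liminf u" and v: "v \<longlonglongrightarrow> b"
  shows "a * b \<le> liminf (\<lambda>n. u n * v n)"
proof -
  have *: "c * b \<le> liminf (\<lambda>n. u n * v n)" if c: "c < a" for c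
  proof -
    have "c < top"
      using less_le_trans[OF c top_greatest] .
    then have "(\<lambda>n. c * v n) \<longlonglongrightarrow> c * b"
      by (intro ennreal_tendsto_cmult v)
    then have "c * b = liminf (\<lambda>n. c * v n)"
      by (simp add: lim_imp_Liminf)
    also have "eventually (\<lambda>n. c < u n) sequentially"
      using u c unfolding le_Liminf_iff by blast
    then have "liminf (\<lambda>n. c * v n) \<le> liminf (\<lambda>n. u n * v n)"
      by (intro Liminf_mono) (auto elim!: eventually_mono intro!: mult_right_mono)
    finally show ?thesis .
  qed
  have "a * b = (SUP c\<in>{..<a}. c) * b"
    \<comment> \<open>For \<open>a = 0\<close> the supremum runs over the empty set, and its value
      \<open>bot\<close> is 0.\<close>
    by (cases "a = 0") (simp_all add: bot_ennreal)
  also have "\<dots> = (SUP c\<in>{..<a}. c * b)"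
    by (rule SUP_mult_right_ennreal)
  also have "\<dots> \<le> liminf (\<lambda>n. u n * v n)"
    using * by (intro SUP_least) auto
  finally show ?thesis .
qed

lemma lsc_on_mult_continuous:
  fixes f g :: "'a::topological_space \<Rightarrow> ennreal"
  assumes "lsc_on S f" "continuous_on S g"
  shows "lsc_on S (\<lambda>x. f x * g x)"
  unfolding lsc_on_def
proof (intro ballI allI impI, elim conjE)
  fix x X assume X: "x \<in> S" "\<forall>n. X n \<in> S" "X \<longlonglongrightarrow> x"
  have "(\<lambda>n. g (X n)) \<longlonglongrightarrow> g x"
    using X by (intro continuous_on_tendsto_compose[OF assms(2)]) auto
  then show "f x * g x \<le> liminf (\<lambda>n. f (X n) * g (X n))"
    using X assms(1) by (intro liminf_mult_ge lsc_onD[of S f]) auto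
qed

lemma lsc_on_compose:
  assumes "lsc_on T f" "continuous_on S h" "\<And>x. x \<in> S \<Longrightarrow> h x \<in> T"
  shows "lsc_on S (\<lambda>x. f (h x))"
  unfolding lsc_on_def
proof (intro ballI allI impI, elim conjE)
  fix x X assume X: "x \<in> S" "\<forall>n. X n \<in> S" "X \<longlonglongrightarrow> x"
  have "(\<lambda>n. h (X n)) \<longlonglongrightarrow> h x"
    using X by (intro continuous_on_tendsto_compose[OF assms(2)]) auto
  then show "f (h x) \<le> liminf (\<lambda>n. f (h (X n)))"
    using X assms(3) by (intro lsc_onD[OF assms(1)]) auto
qed

lemma lsc_on_nn_integral:
  assumes "\<And>z. z \<in> space N \<Longrightarrow> lsc_on S (\<lambda>x. f x z)"
    and "\<And>x. x \<in> S \<Longrightarrow> f x \<in> borel_measurable N"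
  shows "lsc_on S (\<lambda>x. \<integral>\<^sup>+z. f x z \<partial>N)"
  unfolding lsc_on_def
proof (intro ballI allI impI, elim conjE)
  fix x X assume X: "x \<in> S" "\<forall>n. X n \<in> S" "X \<longlonglongrightarrow> x"
  have "(\<integral>\<^sup>+z. f x z \<partial>N) \<le> (\<integral>\<^sup>+z. liminf (\<lambda>n. f (X n) z) \<partial>N)"
    using X assms(1) by (intro nn_integral_mono lsc_onD[where S = S]) auto
  also have "\<dots> \<le> liminf (\<lambda>n. \<integral>\<^sup>+z. f (X n) z \<partial>N)"
    using X assms(2) by (intro nn_integral_liminf) auto
  finally show "(\<integral>\<^sup>+z. f x z \<partial>N) \<le> liminf (\<lambda>n. \<integral>\<^sup>+z. f (X n) z \<partial>N)" .
qed

text \<open>A minimising sequence has a convergent subsequence by compactness, and semicontinuity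
  keeps the value at its limit from exceeding the infimum.\<close>

lemma lsc_on_attains_INF:
  fixes f :: "'a::first_countable_topology \<Rightarrow> ennreal"
  assumes "compact K" "K \<noteq> {}" "lsc_on K f"
  obtains x where "x \<in> K" "f x = (INF x\<in>K. f x)"
proof -
  obtain u where u: "\<And>n. u n \<in> f ` K" "u \<longlonglongrightarrow> Inf (f ` K)"
    using Inf_as_limit[of "f ` K"] assms(2) by auto
  then have "\<forall>n. \<exists>x\<in>K. u n = f x"
    by blast
  then obtain X where X: "\<And>n. X n \<in> K" "\<And>n. u n = f (X n)"
    by metis
  obtain x r where x: "x \<in> K" "strict_mono r" "(X \<circ> r) \<longlonglongrightarrow> x"
    using compact_imp_seq_compact[OF assms(1)] X(1) unfolding seq_compact_def by metis
  have "f x \<le> liminf (\<lambda>n. f ((X \<circ> r) n))"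
    using x(1) X(1) by (intro lsc_onD[OF assms(3) _ _ x(3)]) auto
  also have "(\<lambda>n. f ((X \<circ> r) n)) \<longlonglongrightarrow> Inf (f ` K)"
    using LIMSEQ_subseq_LIMSEQ[OF u(2) x(2)] X(2) by (simp add: comp_def)
  then have "liminf (\<lambda>n. f ((X \<circ> r) n)) = Inf (f ` K)"
    by (simp add: lim_imp_Liminf)
  finally have "f x = Inf (f ` K)"
    using x(1) by (intro antisym INF_lower)
  with x(1) that show thesis by blast
qed

section \<open>Measurable selection\<close>

text \<open>The values are cut down successively by a countable family of closed sets separating
  points, whenever the intersection is non-empty; in the limit a single point remains. A closed
  set meets the limit iff it meets every stage, by compactness.\<close>

primrec refine_values :: "(nat \<Rightarrow> 'b set) \<Rightarrow> ('a \<Rightarrow> 'b set) \<Rightarrow> nat \<Rightarrow> 'a \<Rightarrow> 'b set" where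
  "refine_values C F 0 x = F x"
| "refine_values C F (Suc n) x =
     (if refine_values C F n x \<inter> C n = {} then refine_values C F n x else refine_values C F n x \<inter> C n)"

text \<open>Closures of the members of a countable basis suffice: for disjoint open \<open>U\<close>
  and \<open>V\<close> around \<open>x\<close> and \<open>y\<close>, a basic set inside
  \<open>U\<close> has its closure in the complement of \<open>V\<close>.\<close>

lemma ex_countable_closed_separating:
  "\<exists>C :: nat \<Rightarrow> 'b::{t2_space,second_countable_topology} set.
     (\<forall>n. closed (C n)) \<and> (\<forall>x y. x \<noteq> y \<longrightarrow> (\<exists>n. x \<in> C n \<and> y \<notin> C n))"
proof -
  obtain B :: "'b set set" where B: "countable B" "topological_basis B"
    using ex_countable_basis by blast
  have ne: "B \<noteq> {}"
    using topological_basisE[OF B(2) open_UNIV UNIV_I] by auto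
  define C where "C n = closure (from_nat_into B n)" for n
  have "\<exists>n. x \<in> C n \<and> y \<notin> C n" if "x \<noteq> y" for x y :: 'b
  proof -
    obtain U V where UV: "open U" "open V" "x \<in> U" "y \<in> V" "U \<inter> V = {}"
      using hausdorff[OF \<open>x \<noteq> y\<close>] by blast
    obtain O' where O': "O' \<in> B" "x \<in> O'" "O' \<subseteq> U"
      using topological_basisE[OF B(2) UV(1,3)] by blast
    obtain n where n: "from_nat_into B n = O'"
      using from_nat_into_surj[OF B(1) O'(1)] by blast
    have "closure O' \<subseteq> - V"
      using UV O' by (intro closure_minimal) auto
    then show ?thesis
      using UV(4) O'(2) closure_subset[of O'] n by (auto simp: C_def intro!: exI[of _ n])
  qed
  then show ?thesis
    by (intro exI[of _ C]) (auto simp: C_def)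
qed

lemma compact_selection:
  fixes F :: "'a \<Rightarrow> 'b::{t2_space,second_countable_topology} set"
  assumes compact: "\<And>x. x \<in> space N \<Longrightarrow> compact (F x)"
    and ne: "\<And>x. x \<in> space N \<Longrightarrow> F x \<noteq> {}"
    and meas: "\<And>C. closed C \<Longrightarrow> {x \<in> space N. F x \<inter> C \<noteq> {}} \<in> sets N"
  shows "\<exists>\<psi> \<in> borel_measurable N. \<forall>x\<in>space N. \<psi> x \<in> F x"
proof -
  obtain C :: "nat \<Rightarrow> 'b set" where closed: "\<And>n. closed (C n)"
    and sep: "\<And>x y. x \<noteq> y \<Longrightarrow> \<exists>n. x \<in> C n \<and> y \<notin> C n"
    using ex_countable_closed_separating by metis
  let ?F = "refine_values C F"
  have cF: "compact (?F n x)" and neF: "?F n x \<noteq> {}" if "x \<in> space N" for n x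
    using that compact ne closed by (induction n) (auto intro: compact_Int_closed)
  have "decseq (\<lambda>n. ?F n x)" for x
    by (rule decseq_SucI) auto
  then have dec: "?F n x \<subseteq> ?F m x" if "m \<le> n" for m n x
    using that by (auto dest: decseqD)
  have measF: "{x \<in> space N. ?F n x \<inter> D \<noteq> {}} \<in> sets N" if "closed D" for n D
    using that
  proof (induction n arbitrary: D)
    case (Suc n)
    have sets: "{x \<in> space N. ?F n x \<inter> C n \<noteq> {}} \<in> sets N"
      "{x \<in> space N. ?F n x \<inter> (C n \<inter> D) \<noteq> {}} \<in> sets N"
      "{x \<in> space N. ?F n x \<inter> D \<noteq> {}} \<in> sets N"
      using Suc.IH[OF closed] Suc.IH[OF closed_Int[OF closed Suc.prems]] Suc.IH[OF Suc.prems] by auto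
    \<comment> \<open>Where stage \<open>n\<close> cuts, meeting \<open>D\<close> afterwards means
      meeting \<open>C n \<inter> D\<close> before; elsewhere nothing changes. This is why the
      induction has to range over all closed \<open>D\<close>.\<close>
    have "{x \<in> space N. ?F (Suc n) x \<inter> D \<noteq> {}} =
      ({x \<in> space N. ?F n x \<inter> C n \<noteq> {}} \<inter> {x \<in> space N. ?F n x \<inter> (C n \<inter> D) \<noteq> {}}) \<union>
      ({x \<in> space N. ?F n x \<inter> D \<noteq> {}} - {x \<in> space N. ?F n x \<inter> C n \<noteq> {}})"
      by (auto simp: Int_assoc)
    also have "\<dots> \<in> sets N"
      using sets by (intro sets.Un sets.Int sets.Diff)
    finally show ?case .
  qed (use meas in auto)
  have meets: "(\<Inter>n. ?F n x) \<inter> D \<noteq> {}"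
    if x: "x \<in> space N" and D: "closed D" "\<And>n. ?F n x \<inter> D \<noteq> {}" for x D
  proof -
    have "(F x \<inter> D) \<inter> (\<Inter>n\<in>UNIV. ?F n x) \<noteq> {}"
    proof (rule compact_imp_fip_image)
      show "compact (F x \<inter> D)"
        using compact[OF x] D(1) by (rule compact_Int_closed)
      show "closed (?F n x)" for n
        using cF[OF x] by (rule compact_imp_closed)
      fix I :: "nat set" assume I: "finite I"
      \<comment> \<open>The stages decrease, so the latest one lies below any finite family. Adding
        0 covers the empty family and also brings in \<open>F x\<close> itself.\<close>
      have "?F (Max (insert 0 I)) x \<subseteq> ?F i x" if "i \<in> insert 0 I" for i
        using I that by (intro dec Max_ge) auto
      then have "?F (Max (insert 0 I)) x \<inter> D \<subseteq> (F x \<inter> D) \<inter> (\<Inter>i\<in>I. ?F i x)"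
        by fastforce
      then show "(F x \<inter> D) \<inter> (\<Inter>i\<in>I. ?F i x) \<noteq> {}"
        using D(2) by blast
    qed
    then show ?thesis by blast
  qed
  have "\<exists>p. (\<Inter>n. ?F n x) = {p}" if x: "x \<in> space N" for x
  proof -
    obtain p where p: "p \<in> (\<Inter>n. ?F n x)"
      using meets[OF x closed_UNIV] neF[OF x] by auto
    \<comment> \<open>If \<open>C n\<close> contains \<open>q\<close> but not \<open>p\<close>, then
      \<open>q\<close> witnesses that stage \<open>n\<close> cuts with \<open>C n\<close>, and this
      cut would have removed \<open>p\<close>.\<close>
    have "q = p" if q: "q \<in> (\<Inter>n. ?F n x)" for q
    proof (rule ccontr)
      assume "q \<noteq> p"
      then obtain n where n: "q \<in> C n" "p \<notin> C n"
        using sep by blast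
      with q have "?F n x \<inter> C n \<noteq> {}"
        by blast
      then have "?F (Suc n) x \<subseteq> C n"
        by simp
      with p n(2) show False
        by blast
    qed
    with p show ?thesis by blast
  qed
  then obtain \<psi> where \<psi>: "\<And>x. x \<in> space N \<Longrightarrow> (\<Inter>n. ?F n x) = {\<psi> x}"
    by metis
  have closed_pre: "\<psi> -` D \<inter> space N \<in> sets N" if D: "closed D" for D
  proof -
    have "\<psi> -` D \<inter> space N = (\<Inter>n. {x \<in> space N. ?F n x \<inter> D \<noteq> {}})"
    proof (intro equalityI subsetI)
      fix x assume "x \<in> \<psi> -` D \<inter> space N"
      then show "x \<in> (\<Inter>n. {x \<in> space N. ?F n x \<inter> D \<noteq> {}})"
        using \<psi>[of x] by blast
    next
      fix x assume "x \<in> (\<Inter>n. {x \<in> space N. ?F n x \<inter> D \<noteq> {}})"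
      then show "x \<in> \<psi> -` D \<inter> space N"
        using meets[OF _ D, of x] \<psi>[of x] by auto
    qed
    also have "\<dots> \<in> sets N"
      using measF[OF D] by (intro sets.countable_INT) auto
    finally show ?thesis .
  qed
  have "\<psi> \<in> borel_measurable N"
  proof (rule borel_measurableI)
    fix U :: "'b set" assume "open U"
    then have "\<psi> -` (- U) \<inter> space N \<in> sets N"
      by (intro closed_pre) auto
    then have "space N - (\<psi> -` (- U) \<inter> space N) \<in> sets N"
      by (rule sets.compl_sets)
    also have "space N - (\<psi> -` (- U) \<inter> space N) = \<psi> -` U \<inter> space N"
      by auto
    finally show "\<psi> -` U \<inter> space N \<in> sets N" .
  qed
  moreover have "\<psi> x \<in> F x" if "x \<in> space N" for x
  proof -
    have "\<psi> x \<in> ?F 0 x"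
      using \<psi>[OF that] by blast
    then show ?thesis by simp
  qed
  ultimately show ?thesis by blast
qed

section \<open>Closed graphs and minimisation depending on a parameter\<close>

text \<open>The sequential form in which upper hemicontinuity with compact values enters. It is
  stable under intersecting the values with a closed set, even when some of them become
  empty.\<close>

definition closed_graph_on :: "'a::topological_space set \<Rightarrow> ('a \<Rightarrow> 'b::topological_space set) \<Rightarrow> bool" where
  "closed_graph_on S F \<longleftrightarrow>
     (\<forall>x\<in>S. \<forall>X p u. (\<forall>n. X n \<in> S) \<and> X \<longlonglongrightarrow> x \<and> (\<forall>n. u n \<in> F (X n)) \<and> u \<longlonglongrightarrow> p \<longrightarrow> p \<in> F x)"

lemma closed_graph_onD:
  assumes "closed_graph_on S F" "x \<in> S" "\<And>n. X n \<in> S" "X \<longlonglongrightarrow> x" "\<And>n. u n \<in> F (X n)" "u \<longlonglongrightarrow> p"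
  shows "p \<in> F x"
  using assms unfolding closed_graph_on_def by blast

lemma closed_graph_on_Int_closed:
  fixes F :: "'a::topological_space \<Rightarrow> 'b::first_countable_topology set"
  assumes "closed_graph_on S F" "closed C"
  shows "closed_graph_on S (\<lambda>x. F x \<inter> C)"
  unfolding closed_graph_on_def
proof (intro ballI allI impI, elim conjE)
  fix x X p u
  assume "x \<in> S" "\<forall>n. X n \<in> S" "X \<longlonglongrightarrow> x" "\<forall>n. u n \<in> F (X n) \<inter> C" "u \<longlonglongrightarrow> p"
  moreover from this have "p \<in> C"
    using assms(2) unfolding closed_sequential_limits by blast
  ultimately show "p \<in> F x \<inter> C"
    using closed_graph_onD[OF assms(1), of x X u p] by blast
qed

text \<open>A constant sequence of base points shows that each value is closed.\<close>

lemma closed_graph_on_compact: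
  fixes F :: "'a::topological_space \<Rightarrow> 'b::metric_space set"
  assumes "closed_graph_on S F" "x \<in> S" "compact K" "F x \<subseteq> K"
  shows "compact (F x)"
proof -
  have "closed (F x)"
    unfolding closed_sequential_limits
    using closed_graph_onD[OF assms(1,2), of "\<lambda>_. x"] assms(2) by auto
  then have "compact (K \<inter> F x)"
    using assms(3) by (intro compact_Int_closed)
  then show ?thesis
    using assms(4) by (simp add: Int_absorb1)
qed

text \<open>Near-minimisers along the sequence accumulate in \<open>K\<close>, and the closed graph
  puts their limit into \<open>F x\<close>. The slack \<open>\<beta> > \<alpha>\<close> provides
  them without attainment. Empty values are permitted: there the infimum is
  \<open>top\<close>.\<close>

lemma lsc_on_INF:
  fixes g :: "'a::first_countable_topology \<Rightarrow> 'b::metric_space \<Rightarrow> ennreal"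
  assumes g: "lsc_on (S \<times> K) (\<lambda>(x, p). g x p)" and K: "compact K"
    and F: "closed_graph_on S F" "\<And>x. x \<in> S \<Longrightarrow> F x \<subseteq> K"
  shows "lsc_on S (\<lambda>x. INF p\<in>F x. g x p)"
proof (rule lsc_onI_bound)
  fix x X \<alpha>
  assume X: "x \<in> S" "\<And>n. X n \<in> S" "X \<longlonglongrightarrow> x" and le: "\<And>n. (INF p\<in>F (X n). g (X n) p) \<le> \<alpha>"
  show "(INF p\<in>F x. g x p) \<le> \<alpha>"
  proof (rule dense_ge)
    fix \<beta> assume "\<alpha> < \<beta>"
    then have "\<exists>p\<in>F (X n). g (X n) p \<le> \<beta>" for n
      using le_less_trans[OF le[of n] \<open>\<alpha> < \<beta>\<close>] by (auto simp: INF_less_iff intro: less_imp_le)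
    then obtain u where u: "\<And>n. u n \<in> F (X n)" "\<And>n. g (X n) (u n) \<le> \<beta>"
      by metis
    have "\<And>n. u n \<in> K"
      using u X F(2) by blast
    then obtain p r where p: "p \<in> K" "strict_mono r" "(u \<circ> r) \<longlonglongrightarrow> p"
      using K unfolding compact_def by metis
    have Xr: "(X \<circ> r) \<longlonglongrightarrow> x"
      by (rule LIMSEQ_subseq_LIMSEQ[OF X(3) p(2)])
    have "p \<in> F x"
      using X(1,2) u(1) by (intro closed_graph_onD[OF F(1) _ _ Xr _ p(3)]) auto
    have "(\<lambda>(x, p). g x p) (x, p) \<le> \<beta>"
      using X(1,2) u(2) p(1) \<open>\<And>n. u n \<in> K\<close>
      by (intro lsc_on_bound_lim[OF g _ _ tendsto_Pair[OF Xr p(3)]]) auto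
    then have "g x p \<le> \<beta>"
      by simp
    with \<open>p \<in> F x\<close> show "(INF p\<in>F x. g x p) \<le> \<beta>"
      by (rule INF_lower2)
  qed
qed

text \<open>The set of minimisers \<open>A x\<close> is compact, and it meets a closed
  \<open>C\<close> iff \<open>F x \<inter> C\<close> is non-empty and minimising over it costs
  nothing extra. Both infima are lower semicontinuous in \<open>x\<close>, so this condition is
  Borel and \<open>compact_selection\<close> applies. Non-emptiness must be demanded separately,
  since both infima may equal \<open>top\<close>.\<close>

lemma measurable_argmin:
  fixes g :: "'a::first_countable_topology \<Rightarrow> 'b::{metric_space,second_countable_topology} \<Rightarrow> ennreal"
  assumes g: "lsc_on (S \<times> K) (\<lambda>(x, p). g x p)" and K: "compact K"
    and F: "closed_graph_on S F" "\<And>x. x \<in> S \<Longrightarrow> F x \<subseteq> K" "\<And>x. x \<in> S \<Longrightarrow> F x \<noteq> {}"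
  shows "\<exists>\<psi> \<in> borel_measurable (restrict_space borel S).
    \<forall>x\<in>S. \<psi> x \<in> F x \<and> g x (\<psi> x) = (INF p\<in>F x. g x p)"
proof -
  let ?N = "restrict_space borel S :: 'a measure"
  define m where "m C x = (INF p\<in>F x \<inter> C. g x p)" for C x
  define A where "A x = {p \<in> F x. g x p \<le> m UNIV x}" for x
  have gx: "lsc_on L (g x)" if "x \<in> S" "L \<subseteq> K" for x L
  proof -
    have "lsc_on L (\<lambda>p. (\<lambda>(x, p). g x p) (x, p))"
      using that by (intro lsc_on_compose[OF g]) (auto intro!: continuous_intros)
    then show ?thesis by simp
  qed
  have [measurable]: "m C \<in> borel_measurable ?N" if "closed C" for C
    unfolding m_def using F that
    by (intro lsc_on_measurable lsc_on_INF[OF g K] closed_graph_on_Int_closed) auto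
  have attained: "A x \<inter> C \<noteq> {} \<longleftrightarrow> F x \<inter> C \<noteq> {} \<and> m C x \<le> m UNIV x"
    if x: "x \<in> S" and C: "closed C" for x C
  proof (intro iffI conjI)
    assume *: "A x \<inter> C \<noteq> {}"
    then show "F x \<inter> C \<noteq> {}"
      by (auto simp: A_def)
    from * show "m C x \<le> m UNIV x"
      unfolding A_def m_def by (auto intro: INF_lower2)
  next
    assume *: "F x \<inter> C \<noteq> {} \<and> m C x \<le> m UNIV x"
    have "compact (F x \<inter> C)"
      using closed_graph_on_compact[OF F(1) x K F(2)[OF x]] C by (rule compact_Int_closed)
    then obtain p where "p \<in> F x \<inter> C" "g x p = m C x"
      using * x F(2)[OF x] unfolding m_def
      by (elim lsc_on_attains_INF[where f = "g x"]) (auto intro!: gx)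
    with * show "A x \<inter> C \<noteq> {}"
      by (auto simp: A_def)
  qed
  have "\<exists>\<psi> \<in> borel_measurable ?N. \<forall>x\<in>space ?N. \<psi> x \<in> A x"
  proof (rule compact_selection)
    fix x assume "x \<in> space ?N"
    then have x: "x \<in> S"
      by (simp add: space_restrict_space)
    show "A x \<noteq> {}"
      using attained[OF x, of UNIV] F(3)[OF x] by auto
    have "compact (F x)"
      by (rule closed_graph_on_compact[OF F(1) x K F(2)[OF x]])
    have "closed (A x)"
      unfolding closed_sequential_limits
    proof (intro allI impI, elim conjE)
      fix u p assume u: "\<forall>n. u n \<in> A x" "u \<longlonglongrightarrow> p"
      have "p \<in> F x"
        using compact_imp_closed[OF \<open>compact (F x)\<close>] u
        unfolding closed_sequential_limits A_def by blast
      moreover have "g x p \<le> m UNIV x"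
        using u \<open>p \<in> F x\<close> gx[OF x F(2)[OF x]]
        by (intro lsc_on_bound_lim[of "F x" "g x" p u]) (auto simp: A_def)
      ultimately show "p \<in> A x"
        by (simp add: A_def)
    qed
    then have "compact (F x \<inter> A x)"
      using \<open>compact (F x)\<close> by (intro compact_Int_closed)
    then show "compact (A x)"
      by (simp add: A_def Int_absorb1 Collect_conj_eq Int_assoc[symmetric])
  next
    fix C :: "'b set" assume C: "closed C"
    \<comment> \<open>This infimum is 0 where \<open>F x\<close> meets \<open>C\<close> and
      \<open>top\<close> where it does not, so the measurability of the meeting set is itself an
      instance of \<open>lsc_on_INF\<close>.\<close>
    have "(\<lambda>x. INF p\<in>F x \<inter> C. 0 :: ennreal) \<in> borel_measurable ?N"
    proof (intro lsc_on_measurable lsc_on_INF[OF _ K] closed_graph_on_Int_closed F(1) C)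
      show "lsc_on (S \<times> K) (\<lambda>(x, p). 0)"
        by (simp add: lsc_on_def)
    qed (use F(2) in auto)
    then have "{x \<in> space ?N. (INF p\<in>F x \<inter> C. 0 :: ennreal) \<le> 0 \<and> m C x \<le> m UNIV x} \<in> sets ?N"
      using C by measurable
    also have "{x \<in> space ?N. (INF p\<in>F x \<inter> C. 0 :: ennreal) \<le> 0 \<and> m C x \<le> m UNIV x} =
        {x \<in> space ?N. A x \<inter> C \<noteq> {}}"
    proof (intro Collect_cong conj_cong refl)
      fix x assume "x \<in> space ?N"
      then show "((INF p\<in>F x \<inter> C. 0 :: ennreal) \<le> 0 \<and> m C x \<le> m UNIV x) = (A x \<inter> C \<noteq> {})"
        using attained[of x C] C by (cases "F x \<inter> C = {}") (auto simp: space_restrict_space)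
    qed
    finally show "{x \<in> space ?N. A x \<inter> C \<noteq> {}} \<in> sets ?N" .
  qed
  then obtain \<psi> where \<psi>: "\<psi> \<in> borel_measurable ?N" "\<And>x. x \<in> S \<Longrightarrow> \<psi> x \<in> A x"
    by (auto simp: space_restrict_space)
  have "\<psi> x \<in> F x \<and> g x (\<psi> x) = (INF p\<in>F x. g x p)" if "x \<in> S" for x
    using \<psi>(2)[OF that] by (auto simp: A_def m_def intro!: antisym INF_lower)
  with \<psi>(1) show ?thesis by blast
qed

context adaptive_robust
begin

section \<open>The robust Bellman operator\<close>

abbreviation gain :: "nat \<Rightarrow> ('n, 'd) state \<Rightarrow> real^'k \<Rightarrow> real" where
  "gain t y a \<equiv> exp (risk M * discount M ^ t * reward M t (fst y) a)"

abbreviation control_map :: "(('n, 'd) state \<Rightarrow> real^'k) \<Rightarrow> bool" where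
  "control_map f \<equiv> f \<in> state_space M \<rightarrow>\<^sub>M restrict_space borel (controls M)"

abbreviation param_map :: "(('n, 'd) state \<Rightarrow> real^'d) \<Rightarrow> bool" where
  "param_map g \<equiv> g \<in> state_space M \<rightarrow>\<^sub>M restrict_space borel (params M)"

lemma Q_kernel_prob:
  assumes "t < horizon M" "y \<in> states M" "a \<in> controls M" "\<theta> \<in> params M"
  shows "prob_space (Q_kernel M t y a \<theta>)" "sets (Q_kernel M t y a \<theta>) = sets (state_space M)"
    "space (Q_kernel M t y a \<theta>) = states M"
proof -
  have "(y, \<theta>) \<in> space (state_space M \<Otimes>\<^sub>M restrict_space borel (params M))"
    using assms by (simp add: space_pair_measure space_state_space space_restrict_space)
  from measurable_space[OF Q_kernel_measurable[OF assms(1,3)] this]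
  show "prob_space (Q_kernel M t y a \<theta>)" "sets (Q_kernel M t y a \<theta>) = sets (state_space M)"
    by (auto simp: space_prob_algebra)
  then show "space (Q_kernel M t y a \<theta>) = states M"
    using sets_eq_imp_space_eq space_state_space by metis
qed

text \<open>Written over the fixed measure \<open>lborel\<close>, the integral depends on the state
  only through \<open>transition\<close> and on the parameter only through the density, so that
  Fatou's lemma can be applied jointly in both.\<close>

lemma nn_integral_Q_kernel:
  assumes "t < horizon M" "y \<in> states M" "a \<in> controls M" "\<theta> \<in> params M"
    and h [measurable]: "h \<in> borel_measurable (state_space M)"
  shows "(\<integral>\<^sup>+y'. h y' \<partial>Q_kernel M t y a \<theta>) =
    (\<integral>\<^sup>+z. h (transition M t y a z) * ennreal (noise_density M z \<theta>) \<partial>lborel)"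
proof -
  note D = noise_distributed[of "Suc t" \<theta>, simplified, OF assms(4)]
  have [measurable]: "transition M t y a \<in> lborel \<rightarrow>\<^sub>M state_space M"
    "transition M t y a \<in> borel \<rightarrow>\<^sub>M state_space M"
    using transition_measurable[OF assms(1-3)] by simp_all
  have [measurable]: "(\<lambda>z. ennreal (noise_density M z \<theta>)) \<in> borel_measurable lborel"
    "noise M (Suc t) \<in> prob_law M \<theta> \<rightarrow>\<^sub>M lborel"
    using D by (simp_all add: distributed_def)
  then have [measurable]: "noise M (Suc t) \<in> borel_measurable (prob_law M \<theta>)"
    by simp
  have "(\<integral>\<^sup>+y'. h y' \<partial>Q_kernel M t y a \<theta>) =
      (\<integral>\<^sup>+\<omega>. h (transition M t y a (noise M (Suc t) \<omega>)) \<partial>prob_law M \<theta>)"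
    unfolding Q_kernel_def by (subst nn_integral_distr) auto
  also have "\<dots> = (\<integral>\<^sup>+z. h (transition M t y a z) \<partial>distr (prob_law M \<theta>) lborel (noise M (Suc t)))"
    by (subst nn_integral_distr) auto
  also have "distr (prob_law M \<theta>) lborel (noise M (Suc t)) =
      density lborel (\<lambda>z. ennreal (noise_density M z \<theta>))"
    using D by (simp add: distributed_def)
  also have "(\<integral>\<^sup>+z. h (transition M t y a z) \<partial>density lborel (\<lambda>z. ennreal (noise_density M z \<theta>))) =
      (\<integral>\<^sup>+z. ennreal (noise_density M z \<theta>) * h (transition M t y a z) \<partial>lborel)"
    by (subst nn_integral_density) auto
  finally show ?thesis
    by (simp add: mult.commute)
qed

lemma lsc_on_states_measurable: "lsc_on (states M) h \<Longrightarrow> h \<in> borel_measurable (state_space M)"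
  unfolding state_space_def by (rule lsc_on_measurable)

lemma continuous_on_transition:
  assumes "t < horizon M" "a \<in> controls M"
  shows "continuous_on (states M) (\<lambda>y. transition M t y a z)"
proof -
  have "continuous_on UNIV (\<lambda>y :: ('n, 'd) state. dyn M (fst y) a z)"
    by (rule continuous_on_compose2[OF dyn_continuous[OF assms(2)]]) (auto intro: continuous_intros)
  moreover have "continuous_on UNIV (\<lambda>y :: ('n, 'd) state. (\<lambda>(c, z). estim M t c z) (snd y, z))"
    by (rule continuous_on_compose2[OF estim_continuous[OF assms(1)]]) (auto intro!: continuous_intros)
  ultimately show ?thesis
    unfolding transition_def by (auto intro!: continuous_on_Pair intro: continuous_on_subset)
qed

text \<open>The premise on \<open>a\<close> is conditional, here and in the next lemmas, because the
  terminal reward ignores the control and an arbitrary value may then be passed.\<close>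

lemma reward_continuous:
  assumes "t < horizon M \<Longrightarrow> a \<in> controls M" "t \<le> horizon M"
  shows "continuous_on UNIV (\<lambda>x. reward M t x a)"
  using assms run_reward_continuous end_reward_continuous
  by (cases "t = horizon M") (auto simp: reward_def)

lemma continuous_on_gain:
  assumes "t < horizon M \<Longrightarrow> a \<in> controls M" "t \<le> horizon M"
  shows "continuous_on S (\<lambda>y. gain t y a)"
proof -
  have "continuous_on UNIV (\<lambda>y :: ('n, 'd) state. reward M t (fst y) a)"
    by (rule continuous_on_compose2[OF reward_continuous[OF assms]]) (auto intro: continuous_intros)
  then show ?thesis
    by (intro continuous_intros) (auto intro: continuous_on_subset)
qed

text \<open>Each control has its own bound on the reward; the maximum over the finitely many
  controls makes it uniform.\<close>

lemma gain_bounded: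
  assumes "t \<le> horizon M"
  obtains c where "0 \<le> c" "\<And>y a. (t < horizon M \<Longrightarrow> a \<in> controls M) \<Longrightarrow> gain t y a \<le> c"
proof -
  have "\<exists>c. \<forall>x a. (t < horizon M \<longrightarrow> a \<in> controls M) \<longrightarrow> reward M t x a \<le> c"
  proof (cases "t = horizon M")
    case True
    obtain c where "\<And>x. \<bar>end_reward M x\<bar> \<le> c"
      using end_reward_bounded unfolding bounded_iff by auto
    then have "end_reward M x \<le> c" for x
      using abs_le_D1 by blast
    with True show ?thesis
      by (auto simp: reward_def)
  next
    case False
    with assms have t: "t < horizon M"
      by simp
    have "\<forall>a\<in>controls M. \<exists>c. \<forall>x. norm (run_reward M t x a) \<le> c"
      using run_reward_bounded[OF t] unfolding bounded_iff by auto
    then obtain c where c: "\<And>a x. a \<in> controls M \<Longrightarrow> norm (run_reward M t x a) \<le> c a"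
      by metis
    have "run_reward M t x a \<le> Max (c ` controls M)" if "a \<in> controls M" for x a
    proof -
      have "run_reward M t x a \<le> c a"
        using c[OF that, of x] by simp
      also have "c a \<le> Max (c ` controls M)"
        using that controls_finite by (intro Max_ge) auto
      finally show ?thesis .
    qed
    with t show ?thesis
      by (auto simp: reward_def)
  qed
  then obtain c where c: "\<And>x a. (t < horizon M \<Longrightarrow> a \<in> controls M) \<Longrightarrow> reward M t x a \<le> c"
    by blast
  show thesis
  proof (rule that)
    show "gain t y a \<le> exp (risk M * discount M ^ t * c)" if "t < horizon M \<Longrightarrow> a \<in> controls M" for y a
      using c[OF that] risk_pos discount_pos by (auto intro!: mult_left_mono)
  qed simp
qed

lemma region_closed_graph:
  assumes t: "t < horizon M"
  shows "closed_graph_on (states M) (\<lambda>y. region M t (snd y))"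
  unfolding closed_graph_on_def
proof (intro ballI allI impI, elim conjE)
  fix y Y \<theta> u
  assume y: "y \<in> states M" and Y: "\<forall>n. Y n \<in> states M" "Y \<longlonglongrightarrow> y"
    and u: "\<forall>n. u n \<in> region M t (snd (Y n))" "u \<longlonglongrightarrow> \<theta>"
  show "\<theta> \<in> region M t (snd y)"
  proof (rule ccontr)
    assume "\<theta> \<notin> region M t (snd y)"
    moreover have "closed (region M t (snd y))"
      using region_compact[OF t] by (rule compact_imp_closed)
    ultimately obtain e where e: "e > 0" "ball \<theta> e \<inter> region M t (snd y) = {}"
      using open_contains_ball[of "- region M t (snd y)"] by (auto simp: open_closed disjoint_eq_subset_Compl)
    \<comment> \<open>Half the radius leaves room to remove a closed ball: \<open>?E\<close> is
      relatively open, still contains the region at the limit state, and excludes the tail of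
      \<open>u\<close>.\<close>
    let ?E = "params M \<inter> - cball \<theta> (e / 2)"
    have "openin (top_of_set (params M)) ?E"
      by (intro openin_open_Int) auto
    moreover have "region M t (snd y) \<subseteq> ?E"
    proof
      fix p assume p: "p \<in> region M t (snd y)"
      with e(2) have "p \<notin> ball \<theta> e"
        by blast
      with p e(1) region_subset[OF t] show "p \<in> ?E"
        by auto
    qed
    moreover have "snd y \<in> params M"
      using y by (auto simp: states_def)
    ultimately obtain D where D: "open D" "snd y \<in> D" "\<And>c. c \<in> D \<Longrightarrow> region M t c \<subseteq> ?E"
      using region_uhc[OF t] unfolding upper_hemicontinuous_on_def by metis
    have "eventually (\<lambda>n. snd (Y n) \<in> D) sequentially"
      using tendsto_snd[OF Y(2)] D(1,2) by (rule topological_tendstoD)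
    moreover have "eventually (\<lambda>n. u n \<in> ball \<theta> (e / 2)) sequentially"
      using u(2) e(1) by (intro topological_tendstoD) auto
    ultimately have "eventually (\<lambda>n. False) sequentially"
    proof eventually_elim
      case (elim n)
      then have "u n \<in> ?E"
        using D(3) u(1) by blast
      with elim show False by auto
    qed
    then show False by simp
  qed
qed

lemma lsc_on_nn_integral_Q_kernel:
  assumes t: "t < horizon M" and a: "a \<in> controls M" and h: "lsc_on (states M) h"
  shows "lsc_on (states M \<times> params M) (\<lambda>(y, \<theta>). \<integral>\<^sup>+y'. h y' * ennreal (gain t y a) \<partial>Q_kernel M t y a \<theta>)"
proof -
  note [measurable] = lsc_on_states_measurable[OF h]
  let ?f = "\<lambda>(y, \<theta>) z. h (transition M t y a z) * ennreal (noise_density M z \<theta>)"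
  have "lsc_on (states M \<times> params M) (\<lambda>p. (\<integral>\<^sup>+z. ?f p z \<partial>lborel) * ennreal (gain t (fst p) a))"
  proof (intro lsc_on_mult_continuous lsc_on_nn_integral)
    fix z
    have "lsc_on (states M \<times> params M)
        (\<lambda>p. h (transition M t (fst p) a z) * ennreal (noise_density M z (snd p)))"
    proof (intro lsc_on_mult_continuous lsc_on_compose[OF h] continuous_on_ennreal)
      show "continuous_on (states M \<times> params M) (\<lambda>p. transition M t (fst p) a z)"
        by (rule continuous_on_compose2[OF continuous_on_transition[OF t a]]) (auto intro: continuous_intros)
      show "continuous_on (states M \<times> params M) (\<lambda>p. noise_density M z (snd p))"
        by (rule continuous_on_compose2[OF noise_density_continuous]) (auto intro: continuous_intros)
      show "transition M t (fst p) a z \<in> states M" if "p \<in> states M \<times> params M" for p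
        using measurable_space[OF transition_measurable[OF t _ a, of "fst p"], of z] that
        by (auto simp: space_state_space)
    qed
    then show "lsc_on (states M \<times> params M) (\<lambda>p. ?f p z)"
      by (simp add: split_beta)
  next
    fix p assume p: "p \<in> states M \<times> params M"
    have [measurable]: "transition M t (fst p) a \<in> borel \<rightarrow>\<^sub>M state_space M"
      using transition_measurable[OF t _ a, of "fst p"] p by auto
    have [measurable]: "(\<lambda>z. ennreal (noise_density M z (snd p))) \<in> borel_measurable borel"
      using noise_distributed[of 1 "snd p"] p by (auto simp: distributed_def)
    show "?f p \<in> borel_measurable lborel"
      by (simp add: split_beta)
  next
    show "continuous_on (states M \<times> params M) (\<lambda>p. ennreal (gain t (fst p) a))"
      using t a by (intro continuous_on_ennreal continuous_on_compose2[OF continuous_on_gain[of t a "states M"]])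
        (auto intro: continuous_intros)
  qed
  also have "?this \<longleftrightarrow> ?thesis"
  proof (rule lsc_on_cong)
    fix p assume "p \<in> states M \<times> params M"
    then obtain y \<theta> where p: "p = (y, \<theta>)" "y \<in> states M" "\<theta> \<in> params M"
      by auto
    have "h \<in> borel_measurable (Q_kernel M t y a \<theta>)"
      using Q_kernel_prob(2)[OF t p(2) a p(3)] by (simp cong: measurable_cong_sets)
    then show "(\<integral>\<^sup>+z. ?f p z \<partial>lborel) * ennreal (gain t (fst p) a) =
        (case p of (y, \<theta>) \<Rightarrow> \<integral>\<^sup>+y'. h y' * ennreal (gain t y a) \<partial>Q_kernel M t y a \<theta>)"
      using nn_integral_Q_kernel[OF t p(2) a p(3)] p(1) by (simp add: nn_integral_multc)
  qed
  finally show ?thesis .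
qed

text \<open>The bridge from the real Bellman operator to \<open>ennreal\<close>. Boundedness of
  \<open>V\<close> makes its integrals under the probability kernels genuine ones, and it is passed
  on with the factor \<open>gain t y a\<close>.\<close>

lemma ennreal_bellman_inf:
  assumes t: "t < horizon M" and y: "y \<in> states M" and a: "a \<in> controls M"
    and V: "\<And>y. y \<in> states M \<Longrightarrow> 0 \<le> V y" "\<And>y. y \<in> states M \<Longrightarrow> V y \<le> B"
    and V_lsc: "lsc_on (states M) (\<lambda>y. ennreal (V y))"
  shows "ennreal (bellman_inf M t V y a) =
      (INF \<theta>\<in>region M t (snd y). \<integral>\<^sup>+y'. ennreal (V y') * ennreal (gain t y a) \<partial>Q_kernel M t y a \<theta>)"
    and "0 \<le> bellman_inf M t V y a"
    and "bellman_inf M t V y a \<le> B * gain t y a"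
proof -
  have meas: "V \<in> borel_measurable (state_space M)"
  proof -
    \<comment> \<open>Semicontinuity is known only for the \<open>ennreal\<close> version of
      \<open>V\<close>; non-negativity on the states transfers measurability back.\<close>
    have "(\<lambda>y. enn2real (ennreal (V y))) \<in> borel_measurable (state_space M)"
      using lsc_on_states_measurable[OF V_lsc] by measurable
    then show ?thesis
      by (rule measurable_cong[THEN iffD1, rotated]) (use V(1) in \<open>auto simp: space_state_space\<close>)
  qed
  have *: "ennreal (\<integral>y'. V y' * gain t y a \<partial>Q_kernel M t y a \<theta>) =
      (\<integral>\<^sup>+y'. ennreal (V y') * ennreal (gain t y a) \<partial>Q_kernel M t y a \<theta>)"
    and nonneg: "0 \<le> (\<integral>y'. V y' * gain t y a \<partial>Q_kernel M t y a \<theta>)"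
    and bound: "(\<integral>y'. V y' * gain t y a \<partial>Q_kernel M t y a \<theta>) \<le> B * gain t y a"
    if "\<theta> \<in> region M t (snd y)" for \<theta>
  proof -
    have "\<theta> \<in> params M"
      using region_subset[OF t] that by blast
    note Q = Q_kernel_prob[OF t y a this]
    interpret Q: prob_space "Q_kernel M t y a \<theta>"
      by (rule Q(1))
    have [measurable]: "V \<in> borel_measurable (Q_kernel M t y a \<theta>)"
      using meas Q(2) by (simp cong: measurable_cong_sets)
    have int: "integrable (Q_kernel M t y a \<theta>) (\<lambda>y'. V y' * gain t y a)"
      using V Q(3) by (intro Q.integrable_const_bound[of _ "B * gain t y a"])
        (auto simp: abs_mult intro!: AE_I2 mult_right_mono)
    have "(\<integral>\<^sup>+y'. ennreal (V y') * ennreal (gain t y a) \<partial>Q_kernel M t y a \<theta>) =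
        (\<integral>\<^sup>+y'. ennreal (V y' * gain t y a) \<partial>Q_kernel M t y a \<theta>)"
      using V(1) Q(3) by (intro nn_integral_cong) (simp add: ennreal_mult)
    then show "ennreal (\<integral>y'. V y' * gain t y a \<partial>Q_kernel M t y a \<theta>) =
        (\<integral>\<^sup>+y'. ennreal (V y') * ennreal (gain t y a) \<partial>Q_kernel M t y a \<theta>)"
      using int V(1) Q(3) by (subst nn_integral_eq_integral[symmetric]) (auto intro!: AE_I2)
    show "0 \<le> (\<integral>y'. V y' * gain t y a \<partial>Q_kernel M t y a \<theta>)"
      using V(1) Q(3) by (intro Bochner_Integration.integral_nonneg) auto
    show "(\<integral>y'. V y' * gain t y a \<partial>Q_kernel M t y a \<theta>) \<le> B * gain t y a"
      using int V(2) Q(3) by (intro Q.integral_le_const) (auto intro!: AE_I2)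
  qed
  show "ennreal (bellman_inf M t V y a) =
      (INF \<theta>\<in>region M t (snd y). \<integral>\<^sup>+y'. ennreal (V y') * ennreal (gain t y a) \<partial>Q_kernel M t y a \<theta>)"
    unfolding bellman_inf_def using region_nonempty[OF t] nonneg *
    by (subst ennreal_cINF) auto
  show "0 \<le> bellman_inf M t V y a"
    unfolding bellman_inf_def using region_nonempty[OF t] nonneg by (intro cINF_greatest) auto
  obtain \<theta> where \<theta>: "\<theta> \<in> region M t (snd y)"
    using region_nonempty[OF t] by blast
  have "bellman_inf M t V y a \<le> (\<integral>y'. V y' * gain t y a \<partial>Q_kernel M t y a \<theta>)"
    unfolding bellman_inf_def using \<theta> nonneg by (intro cINF_lower bdd_belowI[of _ 0]) auto
  then show "bellman_inf M t V y a \<le> B * gain t y a"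
    using bound[OF \<theta>] by (rule order_trans)
qed

lemma lsc_on_bellman_inf:
  assumes "t < horizon M" "a \<in> controls M"
    and "\<And>y. y \<in> states M \<Longrightarrow> 0 \<le> V y" "\<And>y. y \<in> states M \<Longrightarrow> V y \<le> B"
    and "lsc_on (states M) (\<lambda>y. ennreal (V y))"
  shows "lsc_on (states M) (\<lambda>y. ennreal (bellman_inf M t V y a))"
proof -
  have "lsc_on (states M) (\<lambda>y. INF \<theta>\<in>region M t (snd y).
      \<integral>\<^sup>+y'. ennreal (V y') * ennreal (gain t y a) \<partial>Q_kernel M t y a \<theta>)"
    using assms(1,2,5) region_subset params_compact
    by (intro lsc_on_INF[OF lsc_on_nn_integral_Q_kernel] region_closed_graph) auto
  also have "?this \<longleftrightarrow> ?thesis"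
    using ennreal_bellman_inf(1)[OF assms(1) _ assms(2-5)] by (intro lsc_on_cong) auto
  finally show ?thesis .
qed

section \<open>Regularity of the Bellman recursion\<close>

lemma W_value_horizon: "W_value M (horizon M) y = gain (horizon M) y a"
  by (simp add: W_value.simps[of M "horizon M"] reward_def)

lemma W_value_step: "t < horizon M \<Longrightarrow>
    W_value M t y = Max (bellman_inf M t (W_value M (Suc t)) y ` controls M)"
  by (simp add: W_value.simps[of M t])

text \<open>Bounds and semicontinuity go through one induction because the step for either uses both
  at the next time, by way of \<open>ennreal_bellman_inf\<close>.\<close>

lemma W_value_regular:
  assumes "t \<le> horizon M"
  shows "(\<exists>B. \<forall>y\<in>states M. 0 \<le> W_value M t y \<and> W_value M t y \<le> B) \<and>
    lsc_on (states M) (\<lambda>y. ennreal (W_value M t y))"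
  using assms
proof (induction t rule: inc_induct)
  case base
  obtain c where "\<And>y a. gain (horizon M) y a \<le> c"
    using gain_bounded[OF order_refl] by (metis less_irrefl)
  then have "0 \<le> W_value M (horizon M) y \<and> W_value M (horizon M) y \<le> c" for y
    by (simp add: W_value_horizon[where a = undefined])
  \<comment> \<open>The factor 1 presents the continuous terminal gain as an instance of
    \<open>lsc_on_mult_continuous\<close>.\<close>
  moreover have "lsc_on (states M) (\<lambda>y. 1 * ennreal (gain (horizon M) y undefined))"
    by (intro lsc_on_mult_continuous continuous_on_ennreal continuous_on_gain) (auto simp: lsc_on_def Liminf_const)
  then have "lsc_on (states M) (\<lambda>y. ennreal (W_value M (horizon M) y))"
    by (simp add: W_value_horizon[where a = undefined])
  ultimately show ?case
    by blast
next
  case (step t)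
  then have t: "t < horizon M"
    by simp
  from step obtain B where B: "\<And>y. y \<in> states M \<Longrightarrow> 0 \<le> W_value M (Suc t) y"
    "\<And>y. y \<in> states M \<Longrightarrow> W_value M (Suc t) y \<le> B"
    "lsc_on (states M) (\<lambda>y. ennreal (W_value M (Suc t) y))"
    by blast
  let ?b = "bellman_inf M t (W_value M (Suc t))"
  obtain c where c: "0 \<le> c" "\<And>y a. a \<in> controls M \<Longrightarrow> gain t y a \<le> c"
    using gain_bounded[OF less_imp_le[OF t]] by metis
  have bound: "0 \<le> ?b y a" "?b y a \<le> \<bar>B\<bar> * c" if "y \<in> states M" "a \<in> controls M" for y a
  proof -
    show "0 \<le> ?b y a"
      by (rule ennreal_bellman_inf(2)[OF t that B])
    have "?b y a \<le> B * gain t y a"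
      by (rule ennreal_bellman_inf(3)[OF t that B])
    also have "\<dots> \<le> \<bar>B\<bar> * c"
      using c that by (intro mult_mono) auto
    finally show "?b y a \<le> \<bar>B\<bar> * c" .
  qed
  have bounds: "0 \<le> W_value M t y \<and> W_value M t y \<le> \<bar>B\<bar> * c" if "y \<in> states M" for y
  proof -
    have "W_value M t y \<in> ?b y ` controls M"
      unfolding W_value_step[OF t] using controls_finite controls_nonempty by (intro Max_in) auto
    with bound[OF that] show ?thesis by auto
  qed
  have "lsc_on (states M) (\<lambda>y. SUP a\<in>controls M. ennreal (?b y a))"
    by (intro lsc_on_SUP lsc_on_bellman_inf[OF t _ B])
  moreover have "(SUP a\<in>controls M. ennreal (?b y a)) = ennreal (W_value M t y)" for y
  proof -
    \<comment> \<open>\<open>ennreal\<close> is monotone and so commutes with a finite maximum,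
      which turns the recursion into a supremum covered by \<open>lsc_on_SUP\<close>.\<close>
    have "ennreal (Max (?b y ` controls M)) = Max (ennreal ` ?b y ` controls M)"
      using controls_finite controls_nonempty
      by (intro mono_Max_commute) (auto simp: mono_def ennreal_leI)
    also have "\<dots> = (SUP a\<in>controls M. ennreal (?b y a))"
      using controls_finite controls_nonempty by (simp add: Max_Sup image_image)
    finally show ?thesis
      by (simp add: W_value_step[OF t])
  qed
  ultimately have "lsc_on (states M) (\<lambda>y. ennreal (W_value M t y))"
    by simp
  with bounds show ?case
    by blast
qed

lemma W_value_nonneg: "t \<le> horizon M \<Longrightarrow> y \<in> states M \<Longrightarrow> 0 \<le> W_value M t y"
  using W_value_regular by blast

lemma W_value_lsc: "t \<le> horizon M \<Longrightarrow> lsc_on (states M) (\<lambda>y. ennreal (W_value M t y))"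
  using W_value_regular by blast

lemma W_value_bounded:
  assumes "t \<le> horizon M"
  obtains B where "\<And>y. y \<in> states M \<Longrightarrow> W_value M t y \<le> B"
  using W_value_regular[OF assms] by blast

lemma ennreal_bellman_inf_W:
  assumes "t < horizon M" "y \<in> states M" "a \<in> controls M"
  shows "ennreal (bellman_inf M t (W_value M (Suc t)) y a) = (INF \<theta>\<in>region M t (snd y).
    \<integral>\<^sup>+y'. ennreal (W_value M (Suc t) y') * ennreal (gain t y a) \<partial>Q_kernel M t y a \<theta>)"
proof -
  obtain B where "\<And>y. y \<in> states M \<Longrightarrow> W_value M (Suc t) y \<le> B"
    using W_value_bounded[of "Suc t"] assms(1) by auto
  then show ?thesis
    using assms(1) by (intro ennreal_bellman_inf(1)[OF assms] W_value_nonneg W_value_lsc) auto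
qed

lemma bellman_inf_W_nonneg:
  assumes "t < horizon M" "y \<in> states M" "a \<in> controls M"
  shows "0 \<le> bellman_inf M t (W_value M (Suc t)) y a"
proof -
  obtain B where "\<And>y. y \<in> states M \<Longrightarrow> W_value M (Suc t) y \<le> B"
    using W_value_bounded[of "Suc t"] assms(1) by auto
  then show ?thesis
    using assms(1) by (intro ennreal_bellman_inf(2)[OF assms] W_value_nonneg W_value_lsc) auto
qed

lemma bellman_inf_W_measurable:
  assumes t: "t < horizon M" and a: "a \<in> controls M"
  shows "(\<lambda>y. ennreal (bellman_inf M t (W_value M (Suc t)) y a)) \<in> borel_measurable (state_space M)"
proof -
  obtain B where "\<And>y. y \<in> states M \<Longrightarrow> W_value M (Suc t) y \<le> B"
    using W_value_bounded[of "Suc t"] t by auto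
  then show ?thesis
    using t by (intro lsc_on_states_measurable lsc_on_bellman_inf[OF t a] W_value_nonneg W_value_lsc) auto
qed

lemma bellman_inf_le_W_value:
  "t < horizon M \<Longrightarrow> a \<in> controls M \<Longrightarrow> bellman_inf M t (W_value M (Suc t)) y a \<le> W_value M t y"
  using controls_finite by (simp add: W_value_step)

section \<open>Optimal responses\<close>

text \<open>The maximising controls at a state form a finite, hence compact, set. The states at
  which a given control is maximal form a Borel set, and a finite union of these answers the
  measurability condition for every \<open>C\<close>.\<close>

lemma ex_optimal_control:
  assumes t: "t < horizon M"
  shows "\<exists>f. control_map f \<and> (\<forall>y\<in>states M. W_value M t y = bellman_inf M t (W_value M (Suc t)) y (f y))"
proof -
  let ?b = "\<lambda>y a. ennreal (bellman_inf M t (W_value M (Suc t)) y a)"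
  define F where "F y = {a \<in> controls M. ?b y a = ennreal (W_value M t y)}" for y
  have [measurable]: "(\<lambda>y. ennreal (W_value M t y)) \<in> borel_measurable (state_space M)"
    using t by (intro lsc_on_states_measurable W_value_lsc) auto
  have "\<exists>f \<in> borel_measurable (state_space M). \<forall>y\<in>space (state_space M). f y \<in> F y"
  proof (rule compact_selection)
    fix y assume "y \<in> space (state_space M)"
    show "compact (F y)"
      unfolding F_def using controls_finite by (intro finite_imp_compact) auto
    have "W_value M t y \<in> bellman_inf M t (W_value M (Suc t)) y ` controls M"
      unfolding W_value_step[OF t] using controls_finite controls_nonempty by (intro Max_in) auto
    then show "F y \<noteq> {}"
      by (auto simp: F_def)
  next
    fix C :: "(real^'k) set"
    have "{y \<in> space (state_space M). F y \<inter> C \<noteq> {}} =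
        (\<Union>a\<in>controls M \<inter> C. {y \<in> space (state_space M). ?b y a = ennreal (W_value M t y)})"
      by (auto simp: F_def)
    also have "\<dots> \<in> sets (state_space M)"
    proof (rule sets.finite_UN)
      fix a assume "a \<in> controls M \<inter> C"
      then have [measurable]: "(\<lambda>y. ?b y a) \<in> borel_measurable (state_space M)"
        using bellman_inf_W_measurable[OF t] by auto
      show "{y \<in> space (state_space M). ?b y a = ennreal (W_value M t y)} \<in> sets (state_space M)"
        by measurable
    qed (use controls_finite in auto)
    finally show "{y \<in> space (state_space M). F y \<inter> C \<noteq> {}} \<in> sets (state_space M)" .
  qed
  then obtain f where f: "f \<in> borel_measurable (state_space M)" "\<And>y. y \<in> states M \<Longrightarrow> f y \<in> F y"
    by (auto simp: space_state_space)
  have "control_map f"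
    using f by (intro measurable_restrict_space2) (auto simp: space_state_space F_def)
  moreover have "W_value M t y = bellman_inf M t (W_value M (Suc t)) y (f y)" if "y \<in> states M" for y
    using f(2)[OF that] W_value_nonneg[of t y] bellman_inf_W_nonneg[OF t that, of "f y"] t that
    by (auto simp: F_def)
  ultimately show ?thesis by blast
qed

text \<open>Seen as a map into a countable discrete space, a control map allows functions measurable
  for each fixed control to be glued together.\<close>

lemma control_map_count_space:
  assumes "control_map f"
  shows "f \<in> state_space M \<rightarrow>\<^sub>M count_space (controls M)"
proof -
  have "f -` {a} \<inter> space (state_space M) \<in> sets (state_space M)" for a
    using measurable_sets[of f "state_space M" borel "{a}"] assms
    by (auto simp: measurable_restrict_space2_iff)
  moreover have "f \<in> space (state_space M) \<rightarrow> controls M"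
    using assms by (auto simp: measurable_restrict_space2_iff)
  ultimately show ?thesis
    using controls_finite by (simp add: measurable_count_space_eq2)
qed

lemma control_map_in: "control_map f \<Longrightarrow> y \<in> states M \<Longrightarrow> f y \<in> controls M"
  by (auto simp: measurable_restrict_space2_iff space_state_space)

lemma param_map_in: "param_map g \<Longrightarrow> y \<in> states M \<Longrightarrow> g y \<in> params M"
  by (auto simp: measurable_restrict_space2_iff space_state_space)

text \<open>Since \<open>f\<close> is merely Borel, the objective with \<open>f y\<close> inserted
  need not be semicontinuous in \<open>y\<close>. Minimisers are therefore selected for each fixed
  control, and \<open>s (f y) y\<close> combines these finitely many selectors.\<close>

lemma ex_worst_param:
  assumes t: "t < horizon M" and f: "control_map f"
  shows "\<exists>g. param_map g \<and> (\<forall>y\<in>states M. g y \<in> region M t (snd y) \<and>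
    (\<integral>\<^sup>+y'. ennreal (W_value M (Suc t) y') * ennreal (gain t y (f y)) \<partial>Q_kernel M t y (f y) (g y)) =
      ennreal (bellman_inf M t (W_value M (Suc t)) y (f y)))"
proof -
  let ?g = "\<lambda>a y \<theta>. \<integral>\<^sup>+y'. ennreal (W_value M (Suc t) y') * ennreal (gain t y a) \<partial>Q_kernel M t y a \<theta>"
  have "\<forall>a\<in>controls M. \<exists>\<psi> \<in> borel_measurable (state_space M).
    \<forall>y\<in>states M. \<psi> y \<in> region M t (snd y) \<and> ?g a y (\<psi> y) = (INF \<theta>\<in>region M t (snd y). ?g a y \<theta>)"
    unfolding state_space_def
    using t params_compact region_nonempty[OF t] region_subset[OF t]
    by (intro ballI measurable_argmin[OF lsc_on_nn_integral_Q_kernel] W_value_lsc region_closed_graph) auto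
  then obtain s where s: "\<And>a. a \<in> controls M \<Longrightarrow> s a \<in> borel_measurable (state_space M)"
    "\<And>a y. a \<in> controls M \<Longrightarrow> y \<in> states M \<Longrightarrow> s a y \<in> region M t (snd y)"
    "\<And>a y. a \<in> controls M \<Longrightarrow> y \<in> states M \<Longrightarrow> ?g a y (s a y) = (INF \<theta>\<in>region M t (snd y). ?g a y \<theta>)"
    by metis
  let ?s = "\<lambda>y. s (f y) y"
  have "?s \<in> borel_measurable (state_space M)"
    by (rule measurable_compose_countable'[OF s(1) control_map_count_space[OF f]])
      (auto intro: countable_finite controls_finite)
  then have "param_map ?s"
    using s(2) control_map_in[OF f] region_subset[OF t]
    by (intro measurable_restrict_space2) (auto simp: space_state_space, blast)
  moreover have "?s y \<in> region M t (snd y) \<and>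
      ?g (f y) y (?s y) = ennreal (bellman_inf M t (W_value M (Suc t)) y (f y))" if "y \<in> states M" for y
    using s(2,3)[OF control_map_in[OF f that] that] ennreal_bellman_inf_W[OF t that control_map_in[OF f that]]
    by simp
  ultimately show ?thesis by blast
qed

section \<open>Dynamic programming\<close>

text \<open>The total exponential reward from time \<open>t\<close> on, including the stage at \<open>t\<close>; unlike the
  expectation under \<open>path_law\<close> alone it satisfies a one-step recursion.\<close>

definition payoff ::
  "(nat \<Rightarrow> ('n, 'd) state \<Rightarrow> real^'k) \<Rightarrow> (nat \<Rightarrow> ('n, 'd) state \<Rightarrow> real^'d) \<Rightarrow> nat \<Rightarrow> ('n, 'd) state \<Rightarrow> ennreal" where
  "payoff \<phi> \<psi> t y = ennreal (gain t y (\<phi> t y)) *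
     (\<integral>\<^sup>+\<omega>. ennreal (exp (risk M * (\<Sum>k\<in>{t<..horizon M}.
        discount M ^ k * reward M k (fst (\<omega> k)) (\<phi> k (\<omega> k))))) \<partial>path_law M t \<phi> \<psi> y)"

lemma reward_measurable:
  assumes "k \<le> horizon M" "k < horizon M \<Longrightarrow> control_map f"
  shows "(\<lambda>y. reward M k (fst y) (f y)) \<in> borel_measurable (state_space M)"
proof -
  have cont: "(\<lambda>y :: ('n, 'd) state. reward M k (fst y) a) \<in> borel_measurable (state_space M)"
    if "k < horizon M \<Longrightarrow> a \<in> controls M" for a
  proof -
    have "continuous_on UNIV (\<lambda>y :: ('n, 'd) state. reward M k (fst y) a)"
      by (rule continuous_on_compose2[OF reward_continuous[OF that assms(1)]]) (auto intro: continuous_intros)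
    then show ?thesis
      unfolding state_space_def
      by (intro measurable_restrict_space1 borel_measurable_continuous_onI)
  qed
  show ?thesis
  proof (cases "k = horizon M")
    case True
    then show ?thesis
      using cont[of undefined] by (simp add: reward_def)
  next
    case False
    with assms have "control_map f"
      by simp
    have "(\<lambda>y. (\<lambda>a y. reward M k (fst y) a) (f y) y) \<in> borel_measurable (state_space M)"
      by (rule measurable_compose_countable'[OF cont control_map_count_space[OF \<open>control_map f\<close>]])
        (auto intro: countable_finite controls_finite)
    then show ?thesis .
  qed
qed

lemma path_reward_measurable:
  assumes "\<And>k. k \<in> {t<..<horizon M} \<Longrightarrow> control_map (\<phi> k)"
  shows "(\<lambda>\<omega>. exp (risk M * (\<Sum>k\<in>{t<..horizon M}. discount M ^ k * reward M k (fst (\<omega> k)) (\<phi> k (\<omega> k)))))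
    \<in> borel_measurable (\<Pi>\<^sub>M k\<in>{t<..horizon M}. state_space M)"
proof -
  have "(\<lambda>\<omega>. reward M k (fst (\<omega> k)) (\<phi> k (\<omega> k))) \<in> borel_measurable (\<Pi>\<^sub>M k\<in>{t<..horizon M}. state_space M)"
    if "k \<in> {t<..horizon M}" for k
    using measurable_compose[OF measurable_component_singleton[OF that] reward_measurable[of k "\<phi> k"]] that assms[of k]
    by auto
  then show ?thesis
    by (intro borel_measurable_exp[THEN measurable_compose[rotated]] borel_measurable_times borel_measurable_sum
        borel_measurable_const)
qed

lemma payoff_horizon: "payoff \<phi> \<psi> (horizon M) y = ennreal (W_value M (horizon M) y)"
proof -
  have "prob_space (path_law M (horizon M) \<phi> \<psi> y)"
    by (auto simp: path_law_def space_PiM intro!: prob_space_return)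
  note prob_space.emeasure_space_1[OF this]
  then show ?thesis
    by (simp add: payoff_def W_value_horizon[of y "\<phi> (horizon M) y"])
qed

text \<open>The path law is a bind over the first transition. Under it the reward of the coordinate
  \<open>Suc t\<close> splits off the sum and becomes the leading factor of the next payoff, so the
  path integral collapses to one kernel integral.\<close>

lemma payoff_step:
  assumes t: "t < horizon M" and y: "y \<in> states M"
    and \<phi>: "\<And>k. k \<in> {t..<horizon M} \<Longrightarrow> control_map (\<phi> k)"
    and \<psi>: "\<And>k. k \<in> {t..<horizon M} \<Longrightarrow> param_map (\<psi> k)"
  shows "payoff \<phi> \<psi> t y =
    (\<integral>\<^sup>+y'. payoff \<phi> \<psi> (Suc t) y' * ennreal (gain t y (\<phi> t y)) \<partial>Q_kernel M t y (\<phi> t y) (\<psi> t y))"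
    and "payoff \<phi> \<psi> (Suc t) \<in> borel_measurable (state_space M)"
proof -
  define n where "n = horizon M - Suc t"
  have T: "horizon M = Suc (t + n)" "horizon M - t = Suc n" "horizon M - Suc t = n"
    using t by (auto simp: n_def)
  define E where "E t \<omega> = ennreal (exp (risk M * (\<Sum>k\<in>{t<..horizon M}.
        discount M ^ k * reward M k (fst (\<omega> k)) (\<phi> k (\<omega> k)))))" for t \<omega>
  let ?I = "{Suc t<..horizon M}" and ?J = "{t<..horizon M}"
  let ?P = "path_steps M \<phi> \<psi> n (Suc t)"
  let ?K = "Q_kernel M t y (\<phi> t y) (\<psi> t y)"
  have P: "?P \<in> state_space M \<rightarrow>\<^sub>M prob_algebra (\<Pi>\<^sub>M k\<in>?I. state_space M)"
    using path_steps_measurable[of "Suc t" n \<phi> \<psi>] T \<phi> \<psi> by auto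
  have J: "?J = insert (Suc t) ?I"
    using t by auto
  have upd: "(\<lambda>(y', \<omega>). fun_upd \<omega> (Suc t) y') \<in> state_space M \<Otimes>\<^sub>M (\<Pi>\<^sub>M k\<in>?I. state_space M)
      \<rightarrow>\<^sub>M (\<Pi>\<^sub>M k\<in>?J. state_space M)"
    unfolding J split_beta' by (rule measurable_fun_upd[where J = ?I]) auto
  note K = Q_kernel_prob[OF t y control_map_in[OF \<phi> y] param_map_in[OF \<psi> y], of t t]
  have K': "sets ?K = sets (state_space M)" "space ?K = states M"
    using K(2,3) t by auto
  have D: "(\<lambda>y'. distr (?P y') (\<Pi>\<^sub>M k\<in>?J. state_space M) (\<lambda>\<omega>. fun_upd \<omega> (Suc t) y'))
      \<in> ?K \<rightarrow>\<^sub>M subprob_algebra (\<Pi>\<^sub>M k\<in>?J. state_space M)"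
    using measurable_prob_algebraD[OF measurable_distr_prob_space2[OF P upd]]
    by (simp cong: measurable_cong_sets add: K'(1))
  have E_meas: "E s \<in> borel_measurable (\<Pi>\<^sub>M k\<in>{s<..horizon M}. state_space M)" if "t \<le> s" for s
    using path_reward_measurable[of s \<phi>] \<phi> that unfolding E_def
    by (intro measurable_compose[OF _ measurable_ennreal]) auto
  have payoff_Suc: "payoff \<phi> \<psi> (Suc t) y' =
      ennreal (gain (Suc t) y' (\<phi> (Suc t) y')) * (\<integral>\<^sup>+\<omega>. E (Suc t) \<omega> \<partial>?P y')" for y'
    by (simp add: payoff_def E_def path_law_def T(3))
  have "(\<lambda>y'. \<integral>\<^sup>+\<omega>. E (Suc t) \<omega> \<partial>?P y') \<in> borel_measurable (state_space M)"
    using measurable_compose[OF measurable_prob_algebraD[OF P] nn_integral_measurable_subprob_algebra[OF E_meas[of "Suc t"]]]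
    by simp
  moreover have "(\<lambda>y'. ennreal (gain (Suc t) y' (\<phi> (Suc t) y'))) \<in> borel_measurable (state_space M)"
    using reward_measurable[of "Suc t" "\<phi> (Suc t)"] \<phi>[of "Suc t"] t by simp
  ultimately show meas: "payoff \<phi> \<psi> (Suc t) \<in> borel_measurable (state_space M)"
    unfolding payoff_Suc[abs_def] by (intro borel_measurable_times_ennreal)
  have "(\<integral>\<^sup>+\<omega>. E t \<omega> \<partial>path_law M t \<phi> \<psi> y) =
      (\<integral>\<^sup>+\<omega>. E t \<omega> \<partial>(?K \<bind> (\<lambda>y'. distr (?P y') (\<Pi>\<^sub>M k\<in>?J. state_space M) (\<lambda>\<omega>. fun_upd \<omega> (Suc t) y'))))"
    unfolding path_law_def T(2) path_steps.simps using T(1) by simp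
  also have "\<dots> = (\<integral>\<^sup>+y'. \<integral>\<^sup>+\<omega>. E t \<omega> \<partial>distr (?P y') (\<Pi>\<^sub>M k\<in>?J. state_space M) (\<lambda>\<omega>. fun_upd \<omega> (Suc t) y') \<partial>?K)"
    by (rule nn_integral_bind[OF E_meas D]) simp
  also have "\<dots> = (\<integral>\<^sup>+y'. payoff \<phi> \<psi> (Suc t) y' \<partial>?K)"
  proof (rule nn_integral_cong)
    fix y' assume "y' \<in> space ?K"
    then have y': "y' \<in> space (state_space M)"
      by (simp add: K' space_state_space)
    have setsP: "sets (?P y') = sets (\<Pi>\<^sub>M k\<in>?I. state_space M)"
      using measurable_space[OF P y'] by (simp add: space_prob_algebra)
    have u: "(\<lambda>\<omega>. fun_upd \<omega> (Suc t) y') \<in> ?P y' \<rightarrow>\<^sub>M (\<Pi>\<^sub>M k\<in>?J. state_space M)"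
      using measurable_compose[OF measurable_Pair1'[OF y'] upd]
      by (simp cong: measurable_cong_sets add: setsP)
    have split: "E t (fun_upd \<omega> (Suc t) y') = ennreal (gain (Suc t) y' (\<phi> (Suc t) y')) * E (Suc t) \<omega>" for \<omega>
    proof -
      have "(\<Sum>k\<in>?J. discount M ^ k * reward M k (fst (fun_upd \<omega> (Suc t) y' k)) (\<phi> k (fun_upd \<omega> (Suc t) y' k))) =
        discount M ^ Suc t * reward M (Suc t) (fst y') (\<phi> (Suc t) y') +
        (\<Sum>k\<in>?I. discount M ^ k * reward M k (fst (\<omega> k)) (\<phi> k (\<omega> k)))"
        unfolding J by (subst sum.insert) (auto intro!: sum.cong)
      then show ?thesis
        unfolding E_def by (simp add: ennreal_mult[symmetric] exp_add[symmetric] algebra_simps)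
    qed
    have "(\<integral>\<^sup>+\<omega>. E t \<omega> \<partial>distr (?P y') (\<Pi>\<^sub>M k\<in>?J. state_space M) (\<lambda>\<omega>. fun_upd \<omega> (Suc t) y')) =
        (\<integral>\<^sup>+\<omega>. E t (fun_upd \<omega> (Suc t) y') \<partial>?P y')"
      using E_meas[of t] by (intro nn_integral_distr[OF u]) simp
    also have "\<dots> = payoff \<phi> \<psi> (Suc t) y'"
      unfolding split payoff_Suc using E_meas[of "Suc t"]
      by (intro nn_integral_cmult) (simp cong: measurable_cong_sets add: setsP)
    finally show "(\<integral>\<^sup>+\<omega>. E t \<omega> \<partial>distr (?P y') (\<Pi>\<^sub>M k\<in>?J. state_space M) (\<lambda>\<omega>. fun_upd \<omega> (Suc t) y')) =
      payoff \<phi> \<psi> (Suc t) y'" .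
  qed
  finally have "payoff \<phi> \<psi> t y = ennreal (gain t y (\<phi> t y)) * (\<integral>\<^sup>+y'. payoff \<phi> \<psi> (Suc t) y' \<partial>?K)"
    by (simp add: payoff_def E_def)
  also have "\<dots> = (\<integral>\<^sup>+y'. payoff \<phi> \<psi> (Suc t) y' * ennreal (gain t y (\<phi> t y)) \<partial>?K)"
    using meas by (subst nn_integral_multc) (simp_all cong: measurable_cong_sets add: K'(1) mult.commute)
  finally show "payoff \<phi> \<psi> t y =
    (\<integral>\<^sup>+y'. payoff \<phi> \<psi> (Suc t) y' * ennreal (gain t y (\<phi> t y)) \<partial>?K)" .
qed

text \<open>Guards the return to the reals, since \<open>enn2real\<close> sends \<open>top\<close>
  to 0 and would destroy a lower bound.\<close>

lemma payoff_finite: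
  assumes "t \<le> horizon M"
    and "\<And>k. k \<in> {t..<horizon M} \<Longrightarrow> control_map (\<phi> k)"
    and "\<And>k. k \<in> {t..<horizon M} \<Longrightarrow> param_map (\<psi> k)"
  shows "\<exists>B. \<forall>y\<in>states M. payoff \<phi> \<psi> t y \<le> ennreal B"
  using assms
proof (induction t rule: inc_induct)
  case base
  obtain B where "\<And>y. y \<in> states M \<Longrightarrow> W_value M (horizon M) y \<le> B"
    using W_value_bounded[OF order_refl] by blast
  then show ?case
    by (auto simp: payoff_horizon intro!: exI[of _ B] ennreal_leI)
next
  case (step t)
  then have t: "t < horizon M"
    by simp
  from step obtain B where B: "\<And>y. y \<in> states M \<Longrightarrow> payoff \<phi> \<psi> (Suc t) y \<le> ennreal B"
    by force
  obtain c where c: "0 \<le> c" "\<And>y a. a \<in> controls M \<Longrightarrow> gain t y a \<le> c"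
    using gain_bounded[OF less_imp_le[OF t]] by metis
  have "payoff \<phi> \<psi> t y \<le> ennreal (\<bar>B\<bar> * c)" if y: "y \<in> states M" for y
  proof -
    have a: "\<phi> t y \<in> controls M" and p: "\<psi> t y \<in> params M"
      using control_map_in[OF step.prems(1) y] param_map_in[OF step.prems(2) y] t by auto
    note Q = Q_kernel_prob[OF t y a p]
    have "payoff \<phi> \<psi> t y =
        (\<integral>\<^sup>+y'. payoff \<phi> \<psi> (Suc t) y' * ennreal (gain t y (\<phi> t y)) \<partial>Q_kernel M t y (\<phi> t y) (\<psi> t y))"
      using step.prems by (intro payoff_step(1) t y) auto
    also have "\<dots> \<le> (\<integral>\<^sup>+y'. ennreal (\<bar>B\<bar> * c) \<partial>Q_kernel M t y (\<phi> t y) (\<psi> t y))"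
    proof (rule nn_integral_mono)
      fix y' assume "y' \<in> space (Q_kernel M t y (\<phi> t y) (\<psi> t y))"
      then have "payoff \<phi> \<psi> (Suc t) y' \<le> ennreal \<bar>B\<bar>"
        using B[of y'] Q(3) by (auto elim!: order_trans intro!: ennreal_leI)
      then have "payoff \<phi> \<psi> (Suc t) y' * ennreal (gain t y (\<phi> t y)) \<le> ennreal \<bar>B\<bar> * ennreal c"
        using c(2)[OF a] by (intro mult_mono ennreal_leI) auto
      then show "payoff \<phi> \<psi> (Suc t) y' * ennreal (gain t y (\<phi> t y)) \<le> ennreal (\<bar>B\<bar> * c)"
        using c(1) by (simp add: ennreal_mult)
    qed
    also have "\<dots> = ennreal (\<bar>B\<bar> * c)"
      using prob_space.emeasure_space_1[OF Q(1)] by simp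
    finally show ?thesis .
  qed
  then show ?case by blast
qed

text \<open>The Bellman infimum lies below the integral at whatever parameter nature plays, and by
  induction replacing the next \<open>W_value\<close> with the next payoff only increases that
  integral.\<close>

lemma W_value_le_payoff:
  assumes "t \<le> horizon M"
    and "\<And>k. k \<in> {t..<horizon M} \<Longrightarrow> control_map (\<phi> k)"
    and "\<And>k. k \<in> {t..<horizon M} \<Longrightarrow> param_map (\<psi> k)"
    and "\<And>k y. k \<in> {t..<horizon M} \<Longrightarrow> y \<in> states M \<Longrightarrow> \<psi> k y \<in> region M k (snd y)"
    and "\<And>k y. k \<in> {t..<horizon M} \<Longrightarrow> y \<in> states M \<Longrightarrow>
      W_value M k y = bellman_inf M k (W_value M (Suc k)) y (\<phi> k y)"
  shows "\<forall>y\<in>states M. ennreal (W_value M t y) \<le> payoff \<phi> \<psi> t y"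
  using assms
proof (induction t rule: inc_induct)
  case base
  show ?case
    by (simp add: payoff_horizon)
next
  case (step t)
  then have t: "t < horizon M"
    by simp
  have IH: "\<forall>y\<in>states M. ennreal (W_value M (Suc t) y) \<le> payoff \<phi> \<psi> (Suc t) y"
    by (rule step.IH) (use step.prems in auto)
  show ?case
  proof
    fix y assume y: "y \<in> states M"
    have a: "\<phi> t y \<in> controls M" and p: "\<psi> t y \<in> params M"
      using control_map_in[OF step.prems(1) y] param_map_in[OF step.prems(2) y] t by auto
    note Q = Q_kernel_prob[OF t y a p]
    have "ennreal (W_value M t y) = (INF \<theta>\<in>region M t (snd y).
        \<integral>\<^sup>+y'. ennreal (W_value M (Suc t) y') * ennreal (gain t y (\<phi> t y)) \<partial>Q_kernel M t y (\<phi> t y) \<theta>)"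
      using step.prems(4)[OF _ y] ennreal_bellman_inf_W[OF t y a] t by simp
    also have "\<dots> \<le> (\<integral>\<^sup>+y'. ennreal (W_value M (Suc t) y') * ennreal (gain t y (\<phi> t y))
        \<partial>Q_kernel M t y (\<phi> t y) (\<psi> t y))"
      using step.prems(3)[OF _ y] t by (intro INF_lower) auto
    also have "\<dots> \<le> (\<integral>\<^sup>+y'. payoff \<phi> \<psi> (Suc t) y' * ennreal (gain t y (\<phi> t y))
        \<partial>Q_kernel M t y (\<phi> t y) (\<psi> t y))"
      using IH Q(3) by (intro nn_integral_mono mult_right_mono) auto
    also have "\<dots> = payoff \<phi> \<psi> t y"
      using step.prems by (intro payoff_step(1)[symmetric] t y) auto
    finally show "ennreal (W_value M t y) \<le> payoff \<phi> \<psi> t y" .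
  qed
qed

text \<open>The dual argument: by induction the payoff is at most the integral of the next
  \<open>W_value\<close>. At a worst parameter this is the Bellman infimum for the control used,
  hence at most the maximum over all controls.\<close>

lemma payoff_le_W_value:
  assumes "t \<le> horizon M"
    and "\<And>k. k \<in> {t..<horizon M} \<Longrightarrow> control_map (\<phi> k)"
    and "\<And>k. k \<in> {t..<horizon M} \<Longrightarrow> param_map (\<psi> k)"
    and "\<And>k y. k \<in> {t..<horizon M} \<Longrightarrow> y \<in> states M \<Longrightarrow>
      (\<integral>\<^sup>+y'. ennreal (W_value M (Suc k) y') * ennreal (gain k y (\<phi> k y)) \<partial>Q_kernel M k y (\<phi> k y) (\<psi> k y)) =
      ennreal (bellman_inf M k (W_value M (Suc k)) y (\<phi> k y))"
  shows "\<forall>y\<in>states M. payoff \<phi> \<psi> t y \<le> ennreal (W_value M t y)"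
  using assms
proof (induction t rule: inc_induct)
  case base
  show ?case
    by (simp add: payoff_horizon)
next
  case (step t)
  then have t: "t < horizon M"
    by simp
  have IH: "\<forall>y\<in>states M. payoff \<phi> \<psi> (Suc t) y \<le> ennreal (W_value M (Suc t) y)"
    by (rule step.IH) (use step.prems in auto)
  show ?case
  proof
    fix y assume y: "y \<in> states M"
    have a: "\<phi> t y \<in> controls M" and p: "\<psi> t y \<in> params M"
      using control_map_in[OF step.prems(1) y] param_map_in[OF step.prems(2) y] t by auto
    note Q = Q_kernel_prob[OF t y a p]
    have "payoff \<phi> \<psi> t y = (\<integral>\<^sup>+y'. payoff \<phi> \<psi> (Suc t) y' * ennreal (gain t y (\<phi> t y))
        \<partial>Q_kernel M t y (\<phi> t y) (\<psi> t y))"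
      using step.prems by (intro payoff_step(1) t y) auto
    also have "\<dots> \<le> (\<integral>\<^sup>+y'. ennreal (W_value M (Suc t) y') * ennreal (gain t y (\<phi> t y))
        \<partial>Q_kernel M t y (\<phi> t y) (\<psi> t y))"
      using IH Q(3) by (intro nn_integral_mono mult_right_mono) auto
    also have "\<dots> = ennreal (bellman_inf M t (W_value M (Suc t)) y (\<phi> t y))"
      using step.prems(3)[OF _ y] t by auto
    also have "\<dots> \<le> ennreal (W_value M t y)"
      by (intro ennreal_leI bellman_inf_le_W_value t a)
    finally show "payoff \<phi> \<psi> t y \<le> ennreal (W_value M t y)" .
  qed
qed

section \<open>From payoffs to the value functions\<close>

lemma control_strategiesD:
  "\<phi> \<in> control_strategies M t \<Longrightarrow> k \<in> {t..<horizon M} \<Longrightarrow> control_map (\<phi> k)"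
  by (auto simp: control_strategies_def PiE_iff)

lemma nature_strategiesD:
  assumes "\<psi> \<in> nature_strategies M t" "k \<in> {t..<horizon M}"
  shows "param_map (\<psi> k)" "y \<in> states M \<Longrightarrow> \<psi> k y \<in> region M k (snd y)"
proof -
  show "param_map (\<psi> k)"
    using assms by (auto simp: nature_strategies_def PiE_iff)
  show "\<psi> k y \<in> region M k (snd y)" if "y \<in> states M"
    using assms that unfolding nature_strategies_def by (cases y) fastforce
qed

lemma ex_worst_strategy:
  assumes t: "t \<le> horizon M" and \<phi>: "\<phi> \<in> control_strategies M t"
  shows "\<exists>\<psi>\<in>nature_strategies M t. \<forall>y\<in>states M. payoff \<phi> \<psi> t y \<le> ennreal (W_value M t y)"
proof -
  have "\<forall>k\<in>{t..<horizon M}. \<exists>g. param_map g \<and> (\<forall>y\<in>states M. g y \<in> region M k (snd y) \<and>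
    (\<integral>\<^sup>+y'. ennreal (W_value M (Suc k) y') * ennreal (gain k y (\<phi> k y)) \<partial>Q_kernel M k y (\<phi> k y) (g y)) =
      ennreal (bellman_inf M k (W_value M (Suc k)) y (\<phi> k y)))"
    using ex_worst_param control_strategiesD[OF \<phi>] by simp
  then obtain g where g: "\<And>k. k \<in> {t..<horizon M} \<Longrightarrow> param_map (g k)"
    "\<And>k y. k \<in> {t..<horizon M} \<Longrightarrow> y \<in> states M \<Longrightarrow> g k y \<in> region M k (snd y)"
    "\<And>k y. k \<in> {t..<horizon M} \<Longrightarrow> y \<in> states M \<Longrightarrow>
    (\<integral>\<^sup>+y'. ennreal (W_value M (Suc k) y') * ennreal (gain k y (\<phi> k y)) \<partial>Q_kernel M k y (\<phi> k y) (g k y)) =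
      ennreal (bellman_inf M k (W_value M (Suc k)) y (\<phi> k y))"
    by metis
  \<comment> \<open>Strategies are extensional functions, so values at times outside the range must
    be erased.\<close>
  let ?\<psi> = "restrict g {t..<horizon M}"
  have "?\<psi> \<in> nature_strategies M t"
    using g(1,2) unfolding nature_strategies_def by force
  moreover have "\<forall>y\<in>states M. payoff \<phi> ?\<psi> t y \<le> ennreal (W_value M t y)"
    using g control_strategiesD[OF \<phi>] by (intro payoff_le_W_value t) (auto simp del: atLeastLessThan_iff)
  ultimately show ?thesis by blast
qed

text \<open>\<open>payoff\<close> contains the gain at time \<open>t\<close>, whereas
  \<open>U_value\<close> keeps it outside the infimum. Being an exponential it is positive and can
  be divided out.\<close>

lemma U_value_eq:
  assumes t: "t \<le> horizon M" and y: "y \<in> states M" and \<phi>: "\<phi> \<in> control_strategies M t"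
  shows "U_value M t \<phi> y = gain t y (\<phi> t y) *
    (INF \<psi>\<in>nature_strategies M t. enn2real (payoff \<phi> \<psi> t y) / gain t y (\<phi> t y))"
proof -
  have "(\<integral>\<omega>. exp (risk M * (\<Sum>k\<in>{t<..horizon M}. discount M ^ k * reward M k (fst (\<omega> k)) (\<phi> k (\<omega> k))))
      \<partial>path_law M t \<phi> \<psi> y) = enn2real (payoff \<phi> \<psi> t y) / gain t y (\<phi> t y)"
    if \<psi>: "\<psi> \<in> nature_strategies M t" for \<psi>
  proof -
    have sets: "sets (path_law M t \<phi> \<psi> y) = sets (\<Pi>\<^sub>M k\<in>{t<..horizon M}. state_space M)"
      using path_law_prob[OF t y \<phi> \<psi>] by (simp add: space_prob_algebra)
    have "(\<integral>\<omega>. exp (risk M * (\<Sum>k\<in>{t<..horizon M}. discount M ^ k * reward M k (fst (\<omega> k)) (\<phi> k (\<omega> k))))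
        \<partial>path_law M t \<phi> \<psi> y) =
      enn2real (\<integral>\<^sup>+\<omega>. ennreal (exp (risk M * (\<Sum>k\<in>{t<..horizon M}.
        discount M ^ k * reward M k (fst (\<omega> k)) (\<phi> k (\<omega> k))))) \<partial>path_law M t \<phi> \<psi> y)"
      using path_reward_measurable[of t \<phi>] control_strategiesD[OF \<phi>]
      by (intro integral_eq_nn_integral) (auto simp: sets cong: measurable_cong_sets)
    then show ?thesis
      by (simp add: payoff_def enn2real_mult)
  qed
  then show ?thesis
    by (simp add: U_value_def path_laws_def image_image)
qed

lemma U_value_le_W_value:
  assumes t: "t \<le> horizon M" and y: "y \<in> states M" and \<phi>: "\<phi> \<in> control_strategies M t"
  shows "U_value M t \<phi> y \<le> W_value M t y"
proof -
  let ?f = "\<lambda>\<psi>. enn2real (payoff \<phi> \<psi> t y) / gain t y (\<phi> t y)"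
  obtain \<psi> where \<psi>: "\<psi> \<in> nature_strategies M t" "payoff \<phi> \<psi> t y \<le> ennreal (W_value M t y)"
    using ex_worst_strategy[OF t \<phi>] y by blast
  have "(INF \<psi>\<in>nature_strategies M t. ?f \<psi>) \<le> ?f \<psi>"
    using \<psi>(1) by (intro cINF_lower bdd_belowI[of _ 0]) auto
  then have "U_value M t \<phi> y \<le> gain t y (\<phi> t y) * ?f \<psi>"
    unfolding U_value_eq[OF assms] by (intro mult_left_mono) auto
  also have "\<dots> = enn2real (payoff \<phi> \<psi> t y)"
    by simp
  also have "\<dots> \<le> W_value M t y"
    using \<psi>(2) W_value_nonneg[OF t y] by (intro enn2real_leI)
  finally show ?thesis .
qed

lemma W_value_le_U_value:
  assumes t: "t \<le> horizon M" and y: "y \<in> states M" and \<phi>: "\<phi> \<in> control_strategies M t"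
    and opt: "\<And>k y. k \<in> {t..<horizon M} \<Longrightarrow> y \<in> states M \<Longrightarrow>
      W_value M k y = bellman_inf M k (W_value M (Suc k)) y (\<phi> k y)"
  shows "W_value M t y \<le> U_value M t \<phi> y"
proof -
  let ?f = "\<lambda>\<psi>. enn2real (payoff \<phi> \<psi> t y) / gain t y (\<phi> t y)"
  have "W_value M t y / gain t y (\<phi> t y) \<le> (INF \<psi>\<in>nature_strategies M t. ?f \<psi>)"
  proof (rule cINF_greatest)
    \<comment> \<open>A real infimum over an empty set would carry no information; the existence of
      an admissible answer already rests on measurable selection.\<close>
    show "nature_strategies M t \<noteq> {}"
      using ex_worst_strategy[OF t \<phi>] by blast
    fix \<psi> assume \<psi>: "\<psi> \<in> nature_strategies M t"
    have "ennreal (W_value M t y) \<le> payoff \<phi> \<psi> t y"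
      by (rule W_value_le_payoff[OF t, rule_format, OF control_strategiesD[OF \<phi>] nature_strategiesD[OF \<psi>] opt y])
    moreover have "\<exists>B. \<forall>y\<in>states M. payoff \<phi> \<psi> t y \<le> ennreal B"
      by (rule payoff_finite[OF t control_strategiesD[OF \<phi>] nature_strategiesD(1)[OF \<psi>]])
    then obtain B where "payoff \<phi> \<psi> t y \<le> ennreal B"
      using y by blast
    then have "payoff \<phi> \<psi> t y < top"
      by (rule le_less_trans) simp
    ultimately have "W_value M t y \<le> enn2real (payoff \<phi> \<psi> t y)"
      using enn2real_mono[of "ennreal (W_value M t y)"] W_value_nonneg[OF t y] by simp
    then show "W_value M t y / gain t y (\<phi> t y) \<le> ?f \<psi>"
      by (intro divide_right_mono) auto
  qed
  then have "gain t y (\<phi> t y) * (W_value M t y / gain t y (\<phi> t y)) \<le> U_value M t \<phi> y"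
    unfolding U_value_eq[OF t y \<phi>] by (intro mult_left_mono) auto
  then show ?thesis
    by simp
qed

lemma restrict_control_strategies:
  "\<phi> \<in> control_strategies M s \<Longrightarrow> s \<le> t \<Longrightarrow> restrict \<phi> {t..<horizon M} \<in> control_strategies M t"
  by (auto simp: control_strategies_def PiE_iff)

lemma U_value_optimal:
  assumes t: "t < horizon M" and y: "y \<in> states M" and \<phi>: "\<phi> \<in> control_strategies M 0"
    and opt: "\<And>k y. k < horizon M \<Longrightarrow> y \<in> states M \<Longrightarrow>
      W_value M k y = bellman_inf M k (W_value M (Suc k)) y (\<phi> k y)"
  shows "U_value M t (restrict \<phi> {t..<horizon M}) y = W_value M t y"
proof -
  note * = restrict_control_strategies[OF \<phi>, of t, simplified]
  show ?thesis
    using t opt by (intro antisym U_value_le_W_value W_value_le_U_value y *) auto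
qed

lemma ex_optimal_strategy:
  "\<exists>\<phi>\<in>control_strategies M 0. \<forall>k<horizon M. \<forall>y\<in>states M.
     W_value M k y = bellman_inf M k (W_value M (Suc k)) y (\<phi> k y)"
proof -
  obtain f where f: "\<And>k. k < horizon M \<Longrightarrow> control_map (f k)"
    "\<And>k y. k < horizon M \<Longrightarrow> y \<in> states M \<Longrightarrow>
      W_value M k y = bellman_inf M k (W_value M (Suc k)) y (f k y)"
    using ex_optimal_control by metis
  then have "restrict f {0..<horizon M} \<in> control_strategies M 0"
    by (auto simp: control_strategies_def)
  then show ?thesis
    using f(2) by (intro bexI[of _ "restrict f {0..<horizon M}"]) auto
qed

lemma U_opt_eq_W_value:
  assumes t: "t \<le> horizon M" and y: "y \<in> states M"
  shows "U_opt M t y = W_value M t y"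
proof (cases "t < horizon M")
  case True
  obtain \<phi> where \<phi>: "\<phi> \<in> control_strategies M 0"
    "\<And>k y. k < horizon M \<Longrightarrow> y \<in> states M \<Longrightarrow>
      W_value M k y = bellman_inf M k (W_value M (Suc k)) y (\<phi> k y)"
    using ex_optimal_strategy by blast
  let ?\<phi> = "restrict \<phi> {t..<horizon M}"
  have \<phi>': "?\<phi> \<in> control_strategies M t"
    using restrict_control_strategies[OF \<phi>(1)] by simp
  \<comment> \<open>The real supremum needs a non-empty set that is bounded above:
    \<open>\<phi>'\<close> gives the first, \<open>U_value_le_W_value\<close> the second.\<close>
  have "(SUP \<phi>\<in>control_strategies M t. U_value M t \<phi> y) = W_value M t y"
  proof (rule antisym)
    show "(SUP \<phi>\<in>control_strategies M t. U_value M t \<phi> y) \<le> W_value M t y"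
      using \<phi>' by (intro cSUP_least U_value_le_W_value t y) auto
    have "W_value M t y = U_value M t ?\<phi> y"
      by (rule U_value_optimal[OF True y \<phi>, symmetric])
    also have "\<dots> \<le> (SUP \<phi>\<in>control_strategies M t. U_value M t \<phi> y)"
      using U_value_le_W_value[OF t y] by (intro cSUP_upper \<phi>' bdd_aboveI[of _ "W_value M t y"]) auto
    finally show "W_value M t y \<le> (SUP \<phi>\<in>control_strategies M t. U_value M t \<phi> y)" .
  qed
  with True show ?thesis
    by (simp add: U_opt_def)
next
  case False
  then show ?thesis
    by (simp add: U_opt_def W_value.simps[of M t])
qed

end

theorem theorem3p5:
  fixes M :: "('n::finite, 'd::finite, 'k::finite, 'm::finite, 'w) robust_model"
  assumes "adaptive_robust M"
  shows "(\<forall>t\<le>horizon M. \<forall>y\<in>states M. U_opt M t y = W_value M t y) \<and>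
    (\<forall>\<phi>\<in>control_strategies M 0.
       (\<forall>t<horizon M. \<forall>y\<in>states M.
          W_value M t y = bellman_inf M t (W_value M (Suc t)) y (\<phi> t y)) \<longrightarrow>
       (\<forall>t<horizon M. \<forall>y\<in>states M.
          U_opt M t y = U_value M t (restrict \<phi> {t..<horizon M}) y))"
proof -
  interpret adaptive_robust M
    by (rule assms)
  show ?thesis
    using U_opt_eq_W_value U_value_optimal by auto
qed

end
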